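(* Let $\eta,\kappa \in \mathbb{Z}_+ \sqcup \{\infty\}$ with $\eta \geqslant 2$. Let $S_{\boldsymbol\lambda}$ be a weighted shift on the directed tree $\mathscr{T}_{\eta,\kappa}$ with nonzero weights $\boldsymbol\lambda = \{\lambda_v\}_{v \in V_{\eta,\kappa}^\circ}$ such that $e_0 \in \mathcal{D}^\infty(S_{\boldsymbol\lambda})$. Suppose that there exists a sequence $\{\mu_i\}_{i=1}^\eta$ of Borel probability measures on $\mathbb{R}_+$ such that $$\int_0^\infty s^n \, d \mu_i(s) = \Big|\prod_{j=2}^{n+1}\lambda_{i,j}\Big|^2, \quad n \in \mathbb{N}, \; i \in J_\eta.$$ Then $S_{\boldsymbol\lambda}$ is subnormal provided one of the following four conditions holds: (i) $\kappa=0$ and $$\sum_{i=1}^\eta |\lambda_{i,1}|^2 \int_0^\infty \frac 1 s\, d \mu_i(s) \leqslant 1;$$ (ii) $0 < \kappa < \infty$ and $$\sum_{i=1}^\eta |\lambda_{i,1}|^2 \int_0^\infty \frac 1 s\, d \mu_i(s) = 1,$$ $$\Big|\prod_{j=0}^{l-1} \lambda_{-j}\Big|^2 \sum_{i=1}^\eta|\lambda_{i,1}|^2 \int_0^\infty \frac 1 {s^{l+1}}\, d \mu_i(s) = 1, \quad l \in J_{\kappa-1},$$ $$\Big|\prod_{j=0}^{\kappa-1} \lambda_{-j}\Big|^2\sum_{i=1}^\eta|\lambda_{i,1}|^2 \int_0^\infty \frac 1 {s^{\kappa+1}}\, d \mu_i(s) \leqslant 1;$$ (iii) $0 < \kappa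 < \infty$ and there exists a Borel probability measure $\nu$ on $\mathbb{R}_+$ such that $$\int_0^\infty s^n \, d \nu(s) = \Big|\prod_{j=\kappa-n}^{\kappa-1}\lambda_{-j}\Big|^2, \quad n \in J_\kappa,$$ $$\int_\sigma s^\kappa \, d \nu(s) = \Big|\prod_{j=0}^{\kappa-1} \lambda_{-j}\Big|^2 \; \sum_{i=1}^\eta |\lambda_{i,1}|^2 \int_\sigma \frac{1}{s} \, d \mu_i(s), \quad \sigma \in \mathfrak{B}(\mathbb{R}_+);$$ (iv) $\kappa=\infty$ and $$\sum_{i=1}^\eta |\lambda_{i,1}|^2 \int_0^\infty \frac 1 s\, d \mu_i(s) = 1, \qquad \Big|\prod_{j=0}^{l-1} \lambda_{-j}\Big|^2 \sum_{i=1}^\eta|\lambda_{i,1}|^2 \int_0^\infty \frac 1 {s^{l+1}}\, d \mu_i(s) = 1, \quad l \in \mathbb{N}.$$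
   Context: Notation: $\mathbb{Z}_+=\{0,1,2,\ldots\}$, $\mathbb{N}=\{1,2,\ldots\}$, $\mathbb{R}_+=[0,\infty)$, $\mathfrak{B}(\mathbb{R}_+)$ is the Borel $\sigma$-algebra of $\mathbb{R}_+$, and $\int_0^\infty$ means the integral over $\mathbb{R}_+$ (including the point $0$). Conventions: $1/0=\infty$, $0\cdot\infty=0$. For $\iota\in\mathbb{Z}_+\sqcup\{\infty\}$, $J_\iota=\{k\in\mathbb{N}\colon k\leqslant\iota\}$ (so $J_0=\varnothing$, $J_\infty=\mathbb{N}$). The directed tree $\mathscr{T}_{\eta,\kappa}=(V_{\eta,\kappa},E_{\eta,\kappa})$ has vertex set $$V_{\eta,\kappa}=\{-k\colon k\in J_\kappa\}\sqcup\{0\}\sqcup\{(i,j)\colon i\in J_\eta,\ j\in\mathbb{N}\}$$ and edge set $$E_{\eta,\kappa}=\{(-k,-k+1)\colon k\in J_\kappa\}\sqcup\{(0,(i,1))\colon i\in J_\eta\}\sqcup\{((i,j),(i,j+1))\colon i\in J_\eta,\ j\in\mathbb{N}\},$$ where $(u,v)\in E_{\eta,\kappa}$ means that $u$ is the parent of $v$, written $u=\mathrm{par}(v)$. If $\kappa<\infty$ the tree has the root $-\kappa$ (the unique vertex without parent) and $V_{\eta,\kappa}^\circ=V_{\eta,\kappa}\setminus\{-\kappa\}$; if $\kappa=\infty$ the tree is rootless and $V_{\eta,\kappa}^\circ=V_{\eta,\kappa}$. Write $\lambda_{i,j}$ for $\lambda_{(i,j)}$. With $V=V_{\eta,\kappa}$,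 $\ell^2(V)$ is the Hilbert space of square summable complex functions on $V$, and $e_u\in\ell^2(V)$ is the characteristic function of $\{u\}$. The weighted shift with weights $\boldsymbol\lambda=\{\lambda_v\}_{v\in V^\circ}\subseteq\mathbb{C}$ is the operator $S_{\boldsymbol\lambda}$ in $\ell^2(V)$ with domain $\mathcal{D}(S_{\boldsymbol\lambda})=\{f\in\ell^2(V)\colon \Lambda f\in\ell^2(V)\}$ and $S_{\boldsymbol\lambda}f=\Lambda f$, where $(\Lambda f)(v)=\lambda_v f(\mathrm{par}(v))$ for $v\in V^\circ$ and $(\Lambda f)(v)=0$ if $v$ is the root. For an operator $A$, $\mathcal{D}^\infty(A)=\bigcap_{n=0}^\infty\mathcal{D}(A^n)$. A densely defined (possibly unbounded) operator $S$ in a complex Hilbert space $\mathcal{H}$ is subnormal if there exist a complex Hilbert space $\mathcal{K}\supseteq\mathcal{H}$ (isometric embedding) and a (possibly unbounded) normal operator $N$ in $\mathcal{K}$ such that $\mathcal{D}(S)\subseteq\mathcal{D}(N)$ and $Sh=Nh$ for all $h\in\mathcal{D}(S)$. *)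

theory Defs
  imports
    "HOL-Probability.Probability"
    "HOL-Algebra.Algebraic_Closure_Type"
    "HOL-Library.Extended_Nat"
begin

section \<open>Complex Hilbert spaces on explicit carriers\<close>

text \<open>The fields \<open>mult\<close> and \<open>one\<close> inherited from rings are not constrained by the library
  locale \<open>module\<close> and carry no meaning here.\<close>

record 'a chilbert = "(complex, 'a) module" +
  ip :: "'a \<Rightarrow> 'a \<Rightarrow> complex"

definition hnorm :: "'a chilbert \<Rightarrow> 'a \<Rightarrow> real" where
  "hnorm H x = sqrt (Re (ip H x x))"

text \<open>Off the carrier the distance is set to \<open>0\<close> because \<open>Metric_space\<close> requires nonnegativity and
  symmetry on the whole type.\<close>

definition hdist :: "'a chilbert \<Rightarrow> 'a \<Rightarrow> 'a \<Rightarrow> real" where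
  "hdist H x y =
     (if x \<in> carrier H \<and> y \<in> carrier H then hnorm H (x \<ominus>\<^bsub>H\<^esub> y) else 0)"

abbreviation htopology :: "'a chilbert \<Rightarrow> 'a topology" where
  "htopology H \<equiv> Metric_space.mtopology (carrier H) (hdist H)"

locale complex_hilbert_space = module "ring_of_type_algebra :: complex ring" H
  for H :: "'a chilbert" (structure) +
  assumes ip_add_left:
      "\<lbrakk>x \<in> carrier H; y \<in> carrier H; z \<in> carrier H\<rbrakk> \<Longrightarrow> ip H (x \<oplus>\<^bsub>H\<^esub> y) z = ip H x z + ip H y z"
    and ip_scale_left:
      "\<lbrakk>x \<in> carrier H; y \<in> carrier H\<rbrakk> \<Longrightarrow> ip H (c \<odot>\<^bsub>H\<^esub> x) y = c * ip H x y"
    and ip_commute: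
      "\<lbrakk>x \<in> carrier H; y \<in> carrier H\<rbrakk> \<Longrightarrow> ip H x y = cnj (ip H y x)"
    and ip_pos:
      "\<lbrakk>x \<in> carrier H; x \<noteq> \<zero>\<^bsub>H\<^esub>\<rbrakk> \<Longrightarrow> 0 < Re (ip H x x)"
    and complete: "Metric_space.mcomplete (carrier H) (hdist H)"

section \<open>Unbounded operators\<close>

text \<open>An operator is given by its graph, so its domain is \<^term>\<open>Domain A\<close>, and powers and products
  (with their natural domains) are \<open>A ^^ n\<close> and relational composition; \<^term>\<open>A O B\<close> applies
  \<^term>\<open>A\<close> first.\<close>

definition linear_operator :: "'a chilbert \<Rightarrow> ('a \<times> 'a) set \<Rightarrow> bool" where
  "linear_operator H A \<longleftrightarrow>
     A \<subseteq> carrier H \<times> carrier H \<and> single_valued A \<and> (\<zero>\<^bsub>H\<^esub>, \<zero>\<^bsub>H\<^esub>) \<in> A \<and>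
     (\<forall>x y x' y'. (x, y) \<in> A \<longrightarrow> (x', y') \<in> A \<longrightarrow> (x \<oplus>\<^bsub>H\<^esub> x', y \<oplus>\<^bsub>H\<^esub> y') \<in> A) \<and>
     (\<forall>c x y. (x, y) \<in> A \<longrightarrow> (c \<odot>\<^bsub>H\<^esub> x, c \<odot>\<^bsub>H\<^esub> y) \<in> A)"

definition densely_defined :: "'a chilbert \<Rightarrow> ('a \<times> 'a) set \<Rightarrow> bool" where
  "densely_defined H A \<longleftrightarrow> htopology H closure_of Domain A = carrier H"

definition closed_operator :: "'a chilbert \<Rightarrow> ('a \<times> 'a) set \<Rightarrow> bool" where
  "closed_operator H A \<longleftrightarrow> closedin (prod_topology (htopology H) (htopology H)) A"

definition adjoint_op :: "'a chilbert \<Rightarrow> ('a \<times> 'a) set \<Rightarrow> ('a \<times> 'a) set" where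
  "adjoint_op H A =
     {(x, y) \<in> carrier H \<times> carrier H. \<forall>(u, v) \<in> A. ip H v x = ip H u y}"

definition normal_operator :: "'a chilbert \<Rightarrow> ('a \<times> 'a) set \<Rightarrow> bool" where
  "normal_operator H N \<longleftrightarrow>
     linear_operator H N \<and> densely_defined H N \<and> closed_operator H N \<and>
     N O adjoint_op H N = adjoint_op H N O N"

text \<open>Since \<open>A ^^ 0\<close> is the identity of the whole type, the index \<open>0\<close> contributes no
  restriction; the index \<open>1\<close> already confines the intersection to the Hilbert space.\<close>

definition smooth_domain :: "('a \<times> 'a) set \<Rightarrow> 'a set" where
  "smooth_domain A = (\<Inter>n. Domain (A ^^ n))"

definition hilbert_isometry :: "'a chilbert \<Rightarrow> 'b chilbert \<Rightarrow> ('a \<Rightarrow> 'b) \<Rightarrow> bool" where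
  "hilbert_isometry H K U \<longleftrightarrow>
     U \<in> carrier H \<rightarrow> carrier K \<and>
     (\<forall>x \<in> carrier H. \<forall>y \<in> carrier H. U (x \<oplus>\<^bsub>H\<^esub> y) = U x \<oplus>\<^bsub>K\<^esub> U y) \<and>
     (\<forall>c. \<forall>x \<in> carrier H. U (c \<odot>\<^bsub>H\<^esub> x) = c \<odot>\<^bsub>K\<^esub> U x) \<and>
     (\<forall>x \<in> carrier H. \<forall>y \<in> carrier H. ip K (U x) (U y) = ip H x y)"

text \<open>HOL cannot quantify existentially over types, so the elements of the larger space \<^term>\<open>K\<close>
  are taken from the type \<^typ>\<open>'a set\<close>. This loses no generality: if some normal
  extension exists, then the smallest subspace reducing it and containing \<^term>\<open>carrier H\<close>
  also carries a normal extension and, when \<^term>\<open>H\<close> is infinite-dimensional, has the same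
  density character and hence the same cardinality as \<^term>\<open>carrier H\<close>; when \<^term>\<open>H\<close> is
  finite-dimensional, a subnormal operator is already normal.\<close>

definition subnormal_operator :: "'a chilbert \<Rightarrow> ('a \<times> 'a) set \<Rightarrow> bool" where
  "subnormal_operator H S \<longleftrightarrow>
     complex_hilbert_space H \<and> linear_operator H S \<and> densely_defined H S \<and>
     (\<exists>(K :: 'a set chilbert) U N.
        complex_hilbert_space K \<and> hilbert_isometry H K U \<and> normal_operator K N \<and>
        (\<forall>(x, y) \<in> S. (U x, U y) \<in> N))"

section \<open>The space of square summable functions\<close>

text \<open>Functions on \<^term>\<open>V\<close> are represented by functions on the type vanishing off \<^term>\<open>V\<close>.\<close>

definition ell2 :: "'v set \<Rightarrow> ('v \<Rightarrow> complex) chilbert" where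
  "ell2 V =
     \<lparr>carrier = {f. (\<forall>v. v \<notin> V \<longrightarrow> f v = 0) \<and> (\<lambda>v. (cmod (f v))\<^sup>2) summable_on V},
      mult = undefined, one = undefined,
      zero = (\<lambda>_. 0), add = (\<lambda>f g v. f v + g v), smult = (\<lambda>c f v. c * f v),
      ip = (\<lambda>f g. \<Sum>\<^sub>\<infinity>v\<in>V. f v * cnj (g v))\<rparr>"

section \<open>The directed tree and its weighted shifts\<close>

text \<open>\<open>Trunk k\<close> stands for the vertex \<open>-k\<close>; in particular \<open>Trunk 0\<close> is the branching vertex \<open>0\<close>.
  \<open>Branch i j\<close> stands for \<open>(i, j)\<close>.\<close>

datatype vertex = Trunk nat | Branch nat nat

definition J :: "enat \<Rightarrow> nat set" where
  "J \<iota> = {k. 1 \<le> k \<and> enat k \<le> \<iota>}"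

definition tree_V :: "enat \<Rightarrow> enat \<Rightarrow> vertex set" where
  "tree_V \<eta> \<kappa> = {Trunk k | k. k \<in> J \<kappa>} \<union> {Trunk 0} \<union> {Branch i j | i j. i \<in> J \<eta> \<and> 1 \<le> j}"

definition tree_E :: "enat \<Rightarrow> enat \<Rightarrow> (vertex \<times> vertex) set" where
  "tree_E \<eta> \<kappa> =
     {(Trunk k, Trunk (k - 1)) | k. k \<in> J \<kappa>} \<union>
     {(Trunk 0, Branch i 1) | i. i \<in> J \<eta>} \<union>
     {(Branch i j, Branch i (j + 1)) | i j. i \<in> J \<eta> \<and> 1 \<le> j}"

text \<open>The root \<open>-\<kappa>\<close> is removed if \<open>\<kappa>\<close> is finite; for \<open>\<kappa> = \<infinity>\<close> the set removed is empty.\<close>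

definition tree_V0 :: "enat \<Rightarrow> enat \<Rightarrow> vertex set" where
  "tree_V0 \<eta> \<kappa> = tree_V \<eta> \<kappa> - {Trunk k | k. enat k = \<kappa>}"

definition parent :: "enat \<Rightarrow> enat \<Rightarrow> vertex \<Rightarrow> vertex" where
  "parent \<eta> \<kappa> v = (THE u. (u, v) \<in> tree_E \<eta> \<kappa>)"

definition shift_map ::
    "enat \<Rightarrow> enat \<Rightarrow> (vertex \<Rightarrow> complex) \<Rightarrow> (vertex \<Rightarrow> complex) \<Rightarrow> vertex \<Rightarrow> complex" where
  "shift_map \<eta> \<kappa> wt f v = (if v \<in> tree_V0 \<eta> \<kappa> then wt v * f (parent \<eta> \<kappa> v) else 0)"

definition weighted_shift ::
    "enat \<Rightarrow> enat \<Rightarrow> (vertex \<Rightarrow> complex) \<Rightarrow> ((vertex \<Rightarrow> complex) \<times> (vertex \<Rightarrow> complex)) set" where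
  "weighted_shift \<eta> \<kappa> wt =
     {(f, shift_map \<eta> \<kappa> wt f) | f.
        f \<in> carrier (ell2 (tree_V \<eta> \<kappa>)) \<and> shift_map \<eta> \<kappa> wt f \<in> carrier (ell2 (tree_V \<eta> \<kappa>))}"

section \<open>Borel probability measures on the half-line\<close>

abbreviation borel_Rplus :: "real measure" where
  "borel_Rplus \<equiv> restrict_space borel {0..}"

definition borel_prob_Rplus :: "real measure \<Rightarrow> bool" where
  "borel_prob_Rplus M \<longleftrightarrow> prob_space M \<and> sets M = sets borel_Rplus"

end

theory Submission
  imports Defs
begin

text \<open>
  Every branch \<open>i\<close> of the tree carries a Stieltjes moment sequence. Put
  \<open>d\<rho>\<^sub>i(s) = |\<lambda>\<^sub>i\<^sub>,\<^sub>1|\<^sup>2 s\<^sup>-\<^sup>1 d\<mu>\<^sub>i(s)\<close>. Then the \<open>n\<close>-th moment of \<open>\<rho>\<^sub>i\<close>, for \<open>n \<ge> 1\<close>, is the squared modulus of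
  the product of the first \<open>n\<close> weights along the branch, while each of the four conditions says that
  \<open>\<Sum>\<^sub>i \<integral> s\<^sup>-\<^sup>k d\<rho>\<^sub>i\<close> is the reciprocal of the squared modulus of the product of the first \<open>k\<close> trunk weights
  (at the root, if there is one, at most this reciprocal). So the trunk continues the moment
  sequences of the branches to negative indices, but only for all branches taken together.

  This suggests one concrete normal extension. On the orthogonal sum of copies of
  \<open>L\<^sup>2(\<rho>\<^sub>i)\<close> indexed by a branch \<open>i\<close> and a level \<open>n\<close> in \<open>\<int>\<close>, let
  \<open>(N F)(i, n, s) = \<surd>s F(i, n - 1, s)\<close>. Moving the level is a unitary operator commuting with
  multiplication by \<open>\<surd>s\<close>, hence \<open>N\<close> is normal (\<open>wcomp_normal\<close>). Send \<open>e\<close> at the vertex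
  \<open>(i, j)\<close> to a multiple of \<open>s\<^sup>j\<^sup>/\<^sup>2\<close> in the copy \<open>(i, j)\<close>, and \<open>e\<close> at the trunk vertex \<open>-k\<close> to a
  multiple of \<open>s\<^sup>-\<^sup>k\<^sup>/\<^sup>2\<close>, spread over the level \<open>-k\<close> of all branches at once. The moment identities say
  that this map is isometric (\<open>vertex_mass\<close>, \<open>nn_integral_embed\<close>), and comparing the weights
  shows that \<open>N\<close> acts on the image as the weighted shift (\<open>embed_shift\<close>).

  Where the condition at the root is a strict inequality, the missing part of the norm
  of \<open>e\<close> at the root is placed on one further layer, whose measure is the point mass at \<open>0\<close>.
  There \<open>\<surd>s = 0\<close>, so \<open>N\<close> annihilates the additional component.

  Condition (iii) describes the measure \<open>\<nu>\<close> that represents the root; integrating powers of \<open>1/s\<close>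
  against it turns (iii) into (ii) (\<open>trunk_mass_of_root_measure\<close>). The quantity \<open>trunk_mass\<close>
  gives all four conditions the same form.

  Both Hilbert spaces involved are \<open>L\<^sup>2\<close> spaces up to the choice of the elements. The locale
  \<open>L2_model\<close> captures this, and completeness, the density criterion and the closedness of
  adjoints are proved in it once.
\<close>

section \<open>Square integrable complex functions\<close>

definition square_integrable :: "'x measure \<Rightarrow> ('x \<Rightarrow> complex) \<Rightarrow> bool" where
  "square_integrable M f \<longleftrightarrow> f \<in> borel_measurable M \<and> integrable M (\<lambda>x. (cmod (f x))\<^sup>2)"

lemma square_integrable_measurable [measurable_dest]:
  "square_integrable M f \<Longrightarrow> f \<in> borel_measurable M"
  by (simp add: square_integrable_def)

lemma square_integrableD:
  "square_integrable M f \<Longrightarrow> integrable M (\<lambda>x. (cmod (f x))\<^sup>2)"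
  by (simp add: square_integrable_def)

lemma square_integrable_iff_nn:
  "square_integrable M f \<longleftrightarrow>
     f \<in> borel_measurable M \<and> (\<integral>\<^sup>+ x. ennreal ((cmod (f x))\<^sup>2) \<partial>M) < \<infinity>"
  by (auto simp: square_integrable_def integrable_iff_bounded)

lemma square_integrable_bound:
  assumes "square_integrable M f" "g \<in> borel_measurable M" "AE x in M. cmod (g x) \<le> cmod (f x)"
  shows "square_integrable M g"
  unfolding square_integrable_def
proof
  show "integrable M (\<lambda>x. (cmod (g x))\<^sup>2)"
    using assms by (intro Bochner_Integration.integrable_bound[OF square_integrableD[OF assms(1)]])
      (auto elim!: eventually_mono intro: power_mono)
qed fact

lemma square_integrable_zero [simp, intro]: "square_integrable M (\<lambda>_. 0)"
  by (simp add: square_integrable_def)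

lemma square_integrable_scale [intro]:
  "square_integrable M f \<Longrightarrow> square_integrable M (\<lambda>x. c * f x)"
  by (auto simp: square_integrable_def norm_mult power_mult_distrib)

lemma cmod_add_power2_le: "(cmod (a + b))\<^sup>2 \<le> 2 * (cmod a)\<^sup>2 + 2 * (cmod b)\<^sup>2"
proof -
  have "(cmod (a + b))\<^sup>2 \<le> (cmod a + cmod b)\<^sup>2" by (simp add: norm_triangle_ineq power_mono)
  also have "\<dots> \<le> 2 * (cmod a)\<^sup>2 + 2 * (cmod b)\<^sup>2"
    using sum_squares_bound[of "cmod a" "cmod b"] by (simp add: power2_sum)
  finally show ?thesis .
qed

lemma square_integrable_add [intro]:
  assumes "square_integrable M f" "square_integrable M g"
  shows "square_integrable M (\<lambda>x. f x + g x)"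
proof -
  have "integrable M (\<lambda>x. 2 * (cmod (f x))\<^sup>2 + 2 * (cmod (g x))\<^sup>2)"
    using assms by (intro Bochner_Integration.integrable_add integrable_mult_right) (auto simp: square_integrable_def)
  then have "integrable M (\<lambda>x. (cmod (f x + g x))\<^sup>2)"
    by (rule Bochner_Integration.integrable_bound)
      (use assms cmod_add_power2_le in \<open>auto simp: square_integrable_def\<close>)
  then show ?thesis using assms by (auto simp: square_integrable_def)
qed

lemma square_integrable_diff [intro]:
  assumes "square_integrable M f" "square_integrable M g"
  shows "square_integrable M (\<lambda>x. f x - g x)"
  using square_integrable_add[OF assms(1) square_integrable_scale[OF assms(2), of "-1"]] by simp

lemma borel_measurable_cnj [measurable (raw)]:
  "f \<in> borel_measurable M \<Longrightarrow> (\<lambda>x. cnj (f x)) \<in> borel_measurable M"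
  by (rule borel_measurable_continuous_on[OF continuous_on_cnj[OF continuous_on_id]])

lemma square_integrable_mult_cnj:
  assumes "square_integrable M f" "square_integrable M g"
  shows "integrable M (\<lambda>x. f x * cnj (g x))"
proof -
  have "integrable M (\<lambda>x. (cmod (f x))\<^sup>2 + (cmod (g x))\<^sup>2)"
    using assms by (auto simp: square_integrable_def)
  then show ?thesis
  proof (rule Bochner_Integration.integrable_bound)
    have "cmod (f x * cnj (g x)) \<le> norm ((cmod (f x))\<^sup>2 + (cmod (g x))\<^sup>2)" for x
      using sum_squares_bound[of "cmod (f x)" "cmod (g x)"] by (auto simp: norm_mult intro: order_trans[rotated])
    then show "AE x in M. cmod (f x * cnj (g x)) \<le> norm ((cmod (f x))\<^sup>2 + (cmod (g x))\<^sup>2)" by simp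
  qed (use assms in \<open>auto simp: square_integrable_def\<close>)
qed

definition L2_norm :: "'x measure \<Rightarrow> ('x \<Rightarrow> complex) \<Rightarrow> real" where
  "L2_norm M f = sqrt (\<integral>x. (cmod (f x))\<^sup>2 \<partial>M)"

lemma L2_norm_nonneg [simp]: "0 \<le> L2_norm M f"
  by (simp add: L2_norm_def)

lemma L2_norm_power2: "(L2_norm M f)\<^sup>2 = (\<integral>x. (cmod (f x))\<^sup>2 \<partial>M)"
  by (simp add: L2_norm_def)

lemma nn_integral_L2_norm:
  assumes "square_integrable M f"
  shows "(\<integral>\<^sup>+ x. ennreal ((cmod (f x))\<^sup>2) \<partial>M) = ennreal ((L2_norm M f)\<^sup>2)"
  using assms by (subst nn_integral_eq_integral) (auto simp: L2_norm_power2 square_integrable_def)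

lemma L2_norm_cong_AE:
  "f \<in> borel_measurable M \<Longrightarrow> g \<in> borel_measurable M \<Longrightarrow> AE x in M. f x = g x \<Longrightarrow> L2_norm M f = L2_norm M g"
  unfolding L2_norm_def by (auto intro!: integral_cong_AE elim!: eventually_mono)

lemma L2_Cauchy_Schwarz_abs:
  assumes "square_integrable M f" "square_integrable M g"
  shows "(\<integral>x. cmod (f x) * cmod (g x) \<partial>M) \<le> L2_norm M f * L2_norm M g"
proof -
  have [measurable]: "f \<in> borel_measurable M" "g \<in> borel_measurable M"
    using assms by (auto simp: square_integrable_def)
  have i: "integrable M (\<lambda>x. cmod (f x) * cmod (g x))"
    using integrable_norm[OF square_integrable_mult_cnj[OF assms]] by (simp add: norm_mult)
  have "ennreal ((\<integral>x. cmod (f x) * cmod (g x) \<partial>M)\<^sup>2)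
      = (\<integral>\<^sup>+ x. ennreal (cmod (f x)) * ennreal (cmod (g x)) \<partial>M)\<^sup>2"
    using nn_integral_eq_integral[OF i] by (simp add: ennreal_mult ennreal_power)
  also have "\<dots> \<le> (\<integral>\<^sup>+ x. (ennreal (cmod (f x)))\<^sup>2 \<partial>M) * (\<integral>\<^sup>+ x. (ennreal (cmod (g x)))\<^sup>2 \<partial>M)"
    by (rule Cauchy_Schwarz_nn_integral) auto
  also have "\<dots> = ennreal ((L2_norm M f * L2_norm M g)\<^sup>2)"
    using nn_integral_L2_norm[OF assms(1)] nn_integral_L2_norm[OF assms(2)]
    by (simp add: ennreal_power ennreal_mult power_mult_distrib)
  finally show ?thesis
    by (simp add: power2_le_iff_abs_le)
qed

lemma L2_Cauchy_Schwarz: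
  assumes "square_integrable M f" "square_integrable M g"
  shows "cmod (\<integral>x. f x * cnj (g x) \<partial>M) \<le> L2_norm M f * L2_norm M g"
proof -
  have "cmod (\<integral>x. f x * cnj (g x) \<partial>M) \<le> (\<integral>x. cmod (f x) * cmod (g x) \<partial>M)"
    using integral_norm_bound[of M "\<lambda>x. f x * cnj (g x)"] by (simp add: norm_mult)
  with L2_Cauchy_Schwarz_abs[OF assms] show ?thesis by linarith
qed

lemma L2_norm_triangle:
  assumes "square_integrable M f" "square_integrable M g"
  shows "L2_norm M (\<lambda>x. f x + g x) \<le> L2_norm M f + L2_norm M g"
proof -
  have i: "integrable M (\<lambda>x. cmod (f x) * cmod (g x))"
    using integrable_norm[OF square_integrable_mult_cnj[OF assms]] by (simp add: norm_mult)
  have j: "integrable M (\<lambda>x. (cmod (f x))\<^sup>2)" "integrable M (\<lambda>x. (cmod (g x))\<^sup>2)"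
    "integrable M (\<lambda>x. (cmod (f x + g x))\<^sup>2)"
    using assms square_integrable_add[OF assms] by (auto simp: square_integrable_def)
  have "(\<integral>x. (cmod (f x + g x))\<^sup>2 \<partial>M)
      \<le> (\<integral>x. (cmod (f x))\<^sup>2 + (cmod (g x))\<^sup>2 + 2 * (cmod (f x) * cmod (g x)) \<partial>M)"
  proof (intro integral_mono Bochner_Integration.integrable_add integrable_mult_right i j)
    fix x
    have "(cmod (f x + g x))\<^sup>2 \<le> (cmod (f x) + cmod (g x))\<^sup>2"
      by (simp add: norm_triangle_ineq power_mono)
    then show "(cmod (f x + g x))\<^sup>2 \<le> (cmod (f x))\<^sup>2 + (cmod (g x))\<^sup>2 + 2 * (cmod (f x) * cmod (g x))"
      by (simp add: power2_sum)
  qed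
  also have "\<dots> = (L2_norm M f)\<^sup>2 + (L2_norm M g)\<^sup>2 + 2 * (\<integral>x. cmod (f x) * cmod (g x) \<partial>M)"
    using i j by (simp add: L2_norm_power2)
  also have "\<dots> \<le> (L2_norm M f + L2_norm M g)\<^sup>2"
    using L2_Cauchy_Schwarz_abs[OF assms] by (simp add: power2_sum)
  finally show ?thesis
    by (simp add: L2_norm_def real_le_lsqrt)
qed

lemma L2_norm_minus_commute: "L2_norm M (\<lambda>x. f x - g x) = L2_norm M (\<lambda>x. g x - f x)"
  by (simp add: L2_norm_def norm_minus_commute)

lemma L2_norm_eq_0_iff:
  assumes "square_integrable M f"
  shows "L2_norm M f = 0 \<longleftrightarrow> (AE x in M. f x = 0)"
  using assms by (simp add: L2_norm_def square_integrable_def integral_nonneg_eq_0_iff_AE)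

text \<open>The Riesz--Fischer theorem. Along a subsequence with consecutive distances below \<open>2\<^sup>-\<^sup>k\<close>, the
  function \<open>\<Sum>\<^sub>k 2\<^sup>k |F\<^sub>k\<^sub>+\<^sub>1 - F\<^sub>k|\<^sup>2\<close> is integrable, hence finite almost everywhere. Since
  \<open>t \<le> 2\<^sup>k t\<^sup>2 + 2\<^sup>-\<^sup>k\<close> for \<open>t \<ge> 0\<close>, this makes the increments absolutely summable at almost every point, and
  Fatou's lemma turns the pointwise limit into a limit in norm.\<close>

lemma L2_complete:
  fixes F :: "nat \<Rightarrow> 'x \<Rightarrow> complex"
  assumes F: "\<And>n. square_integrable M (F n)"
    and Cauchy: "\<And>e. 0 < e \<Longrightarrow> \<exists>N. \<forall>m\<ge>N. \<forall>n\<ge>N. L2_norm M (\<lambda>x. F m x - F n x) < e"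
  obtains f where "square_integrable M f" "(\<lambda>n. L2_norm M (\<lambda>x. F n x - f x)) \<longlonglongrightarrow> 0"
proof -
  have [measurable]: "F n \<in> borel_measurable M" for n
    using F by (auto simp: square_integrable_def)
  have "\<forall>k. \<exists>N. \<forall>m\<ge>N. \<forall>n\<ge>N. L2_norm M (\<lambda>x. F m x - F n x) < (1/2)^k"
    using Cauchy by simp
  then obtain N0 where N0: "\<And>k m n. N0 k \<le> m \<Longrightarrow> N0 k \<le> n \<Longrightarrow> L2_norm M (\<lambda>x. F m x - F n x) < (1/2)^k"
    by metis
  define N where "N = (\<lambda>k. \<Sum>i\<le>k. N0 i)"
  have N: "L2_norm M (\<lambda>x. F m x - F n x) < (1/2)^k" if "N k \<le> m" "N k \<le> n" for k m n
  proof -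
    have "N0 k \<le> N k" unfolding N_def by (rule member_le_sum) auto
    with that show ?thesis by (intro N0) auto
  qed
  have Nmono: "N k \<le> N (Suc k)" for k by (simp add: N_def)
  define D where "D k x = F (N (Suc k)) x - F (N k) x" for k x
  have [measurable]: "D k \<in> borel_measurable M" for k unfolding D_def by simp
  have sqD: "square_integrable M (D k)" for k unfolding D_def using F by auto
  have "(\<integral>\<^sup>+ x. (\<Sum>k. ennreal (2^k * (cmod (D k x))\<^sup>2)) \<partial>M) = (\<Sum>k. \<integral>\<^sup>+ x. ennreal (2^k * (cmod (D k x))\<^sup>2) \<partial>M)"
    by (rule nn_integral_suminf) simp
  also have "\<dots> \<le> (\<Sum>k. ennreal ((1/2)^k))"
  proof (rule suminf_le)
    fix k
    have "(\<integral>\<^sup>+ x. ennreal (2^k * (cmod (D k x))\<^sup>2) \<partial>M) = ennreal (2^k) * ennreal ((L2_norm M (D k))\<^sup>2)"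
      by (simp add: ennreal_mult nn_integral_cmult nn_integral_L2_norm[OF sqD])
    also have "\<dots> = ennreal (2^k * (L2_norm M (D k))\<^sup>2)" by (simp add: ennreal_mult)
    also have "\<dots> \<le> ennreal (2^k * ((1/2)^k)\<^sup>2)"
    proof (intro ennreal_leI mult_left_mono power_mono)
      show "L2_norm M (D k) \<le> (1/2)^k"
        using N[of k "N (Suc k)" "N k"] Nmono[of k] by (simp add: D_def[abs_def])
    qed auto
    also have "2^k * ((1/2)^k)\<^sup>2 = ((1/2::real)^k)"
      by (simp add: power2_eq_square field_simps)
    finally show "(\<integral>\<^sup>+ x. ennreal (2^k * (cmod (D k x))\<^sup>2) \<partial>M) \<le> ennreal ((1/2)^k)" .
  qed auto
  also have "\<dots> = ennreal (\<Sum>k. (1/2)^k)"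
    by (rule suminf_ennreal2) (auto intro: summable_geometric)
  also have "\<dots> < \<infinity>" by simp
  finally have "(\<integral>\<^sup>+ x. (\<Sum>k. ennreal (2^k * (cmod (D k x))\<^sup>2)) \<partial>M) \<noteq> \<infinity>" by simp
  then have AE1: "AE x in M. (\<Sum>k. ennreal (2^k * (cmod (D k x))\<^sup>2)) \<noteq> \<infinity>"
    by (rule nn_integral_PInf_AE[rotated]) measurable
  have conv: "convergent (\<lambda>k. F (N k) x)" if fin: "(\<Sum>k. ennreal (2^k * (cmod (D k x))\<^sup>2)) \<noteq> \<infinity>" for x
  proof -
    have s: "summable (\<lambda>k. 2^k * (cmod (D k x))\<^sup>2)"
      using fin by (intro summable_suminf_not_top) auto
    have g: "summable (\<lambda>k. (1/2::real)^k)" by (rule summable_geometric) simp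
    have "summable (\<lambda>k. cmod (D k x))"
    proof (rule summable_comparison_test[OF _ summable_add[OF s g]], intro exI allI impI)
      fix k
      have p: "(2::real)^k * (1/2)^k = 1" by (simp add: power_mult_distrib[symmetric])
      \<comment> \<open>\<open>2u \<le> u\<^sup>2 + 1\<close> at \<open>u = 2\<^sup>k t\<close>, divided by \<open>2\<^sup>k\<close>, gives \<open>t \<le> 2\<^sup>k t\<^sup>2 + 2\<^sup>-\<^sup>k\<close>.\<close>
      have "2 * (2^k * (cmod (D k x))) * 1 \<le> (2^k * (cmod (D k x)))\<^sup>2 + 1\<^sup>2"
        by (rule sum_squares_bound)
      then have "(1/2)^k * (2^k * cmod (D k x)) \<le> (1/2)^k * ((2^k * (cmod (D k x)))\<^sup>2 + 1)"
        by (intro mult_left_mono) (auto intro: order_trans[rotated])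
      also have "\<dots> = ((2::real)^k * (1/2)^k) * (2^k * (cmod (D k x))\<^sup>2) + (1/2)^k"
        by (simp add: power2_eq_square algebra_simps)
      finally have "((2::real)^k * (1/2)^k) * cmod (D k x)
          \<le> ((2::real)^k * (1/2)^k) * (2^k * (cmod (D k x))\<^sup>2) + (1/2)^k"
        by (simp only: ac_simps)
      then show "norm (cmod (D k x)) \<le> 2^k * (cmod (D k x))\<^sup>2 + (1/2)^k"
        unfolding p by simp
    qed
    then have "summable (\<lambda>k. D k x)" by (rule summable_norm_cancel)
    then have "convergent (\<lambda>n. \<Sum>k<n. D k x)" by (simp add: summable_iff_convergent)
    then have "convergent (\<lambda>n. (\<Sum>k<n. D k x) + F (N 0) x)"
      by (intro convergent_add convergent_const)
    also have "(\<lambda>n. (\<Sum>k<n. D k x) + F (N 0) x) = (\<lambda>n. F (N n) x)"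
      unfolding D_def using sum_lessThan_telescope[of "\<lambda>k. F (N k) x"] by simp
    finally show ?thesis .
  qed
  define f where "f x = lim (\<lambda>k. F (N k) x)" for x
  have [measurable]: "f \<in> borel_measurable M" unfolding f_def by measurable
  have lim: "AE x in M. (\<lambda>k. F (N k) x) \<longlonglongrightarrow> f x"
    using AE1 by eventually_elim (use conv in \<open>auto simp: f_def convergent_LIMSEQ_iff\<close>)
  have bound: "(\<integral>\<^sup>+ x. ennreal ((cmod (F m x - f x))\<^sup>2) \<partial>M) \<le> ennreal (((1/2)^k)\<^sup>2)" if m: "N k \<le> m" for m k
  proof -
    have "(\<integral>\<^sup>+ x. ennreal ((cmod (F m x - f x))\<^sup>2) \<partial>M)
        = (\<integral>\<^sup>+ x. liminf (\<lambda>l. ennreal ((cmod (F m x - F (N l) x))\<^sup>2)) \<partial>M)"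
    proof (rule nn_integral_cong_AE)
      show "AE x in M. ennreal ((cmod (F m x - f x))\<^sup>2) = liminf (\<lambda>l. ennreal ((cmod (F m x - F (N l) x))\<^sup>2))"
        using lim
      proof eventually_elim
        case (elim x)
        then have "(\<lambda>l. ennreal ((cmod (F m x - F (N l) x))\<^sup>2)) \<longlonglongrightarrow> ennreal ((cmod (F m x - f x))\<^sup>2)"
          by (intro tendsto_intros) auto
        then show ?case by (rule lim_imp_Liminf[OF sequentially_bot, symmetric])
      qed
    qed
    also have "\<dots> \<le> liminf (\<lambda>l. \<integral>\<^sup>+ x. ennreal ((cmod (F m x - F (N l) x))\<^sup>2) \<partial>M)"
      by (rule nn_integral_liminf) simp
    also have "\<dots> \<le> liminf (\<lambda>l. ennreal (((1/2)^k)\<^sup>2))"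
    proof (rule Liminf_mono)
      have "incseq N" using Nmono by (rule incseq_SucI)
      show "\<forall>\<^sub>F l in sequentially. (\<integral>\<^sup>+ x. ennreal ((cmod (F m x - F (N l) x))\<^sup>2) \<partial>M) \<le> ennreal (((1/2)^k)\<^sup>2)"
        unfolding eventually_sequentially
      proof (intro exI allI impI)
        fix l assume "k \<le> l"
        then have "N k \<le> N l" using \<open>incseq N\<close> by (simp add: incseqD)
        then have "L2_norm M (\<lambda>x. F m x - F (N l) x) \<le> (1/2)^k"
          using N[of k m "N l"] m by simp
        then show "(\<integral>\<^sup>+ x. ennreal ((cmod (F m x - F (N l) x))\<^sup>2) \<partial>M) \<le> ennreal (((1/2)^k)\<^sup>2)"
          using F by (subst nn_integral_L2_norm) (auto intro!: ennreal_leI power_mono)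
      qed
    qed
    also have "\<dots> = ennreal (((1/2)^k)\<^sup>2)" by (rule Liminf_const) simp
    finally show ?thesis .
  qed
  have "square_integrable M (\<lambda>x. F (N 0) x - f x)"
    unfolding square_integrable_iff_nn using bound[of 0 "N 0"] by (auto intro: le_less_trans)
  from square_integrable_diff[OF F[of "N 0"] this] have sf: "square_integrable M f" by simp
  have "(\<lambda>n. L2_norm M (\<lambda>x. F n x - f x)) \<longlonglongrightarrow> 0"
  proof (rule LIMSEQ_I)
    fix r :: real assume "0 < r"
    then obtain k where k: "(1/2)^k < r"
      using real_arch_pow_inv[of r "1/2"] by auto
    have "norm (L2_norm M (\<lambda>x. F m x - f x) - 0) < r" if "N k \<le> m" for m
    proof -
      have "ennreal ((L2_norm M (\<lambda>x. F m x - f x))\<^sup>2) \<le> ennreal (((1/2)^k)\<^sup>2)"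
        using bound[OF that] nn_integral_L2_norm[OF square_integrable_diff[OF F[of m] sf]] by simp
      then have "(L2_norm M (\<lambda>x. F m x - f x))\<^sup>2 \<le> ((1/2)^k)\<^sup>2"
        by (subst (asm) ennreal_le_iff) auto
      then have "L2_norm M (\<lambda>x. F m x - f x) \<le> (1/2)^k"
        by (rule power2_le_imp_le) simp
      with k show ?thesis by simp
    qed
    then show "\<exists>no. \<forall>n\<ge>no. norm (L2_norm M (\<lambda>x. F n x - f x) - 0) < r" by blast
  qed
  with sf that show ?thesis by blast
qed

section \<open>Hilbert spaces modelled on square integrable functions\<close>

text \<open>The elements of \<open>H\<close> are of an arbitrary type; \<open>dec\<close> reads them as square integrable functions,
  uniquely up to null sets. For \<open>\<ell>\<^sup>2\<close> of the tree the elements are themselves functions, whereas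
  the elements of the larger space in the definition of subnormality have to be sets of functions on
  the vertices, so there \<open>dec\<close> is a genuine coding.\<close>

locale L2_model =
  fixes M :: "'x measure" and H :: "'e chilbert" (structure) and dec :: "'e \<Rightarrow> 'x \<Rightarrow> complex"
  assumes dec_square_integrable: "x \<in> carrier H \<Longrightarrow> square_integrable M (dec x)"
    and dec_surj: "square_integrable M f \<Longrightarrow> \<exists>x\<in>carrier H. AE \<omega> in M. dec x \<omega> = f \<omega>"
    and dec_inj: "x \<in> carrier H \<Longrightarrow> y \<in> carrier H \<Longrightarrow> AE \<omega> in M. dec x \<omega> = dec y \<omega> \<Longrightarrow> x = y"
    and add_closed': "x \<in> carrier H \<Longrightarrow> y \<in> carrier H \<Longrightarrow> x \<oplus> y \<in> carrier H"
    and zero_closed': "\<zero> \<in> carrier H"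
    and scale_closed: "x \<in> carrier H \<Longrightarrow> c \<odot>\<^bsub>H\<^esub> x \<in> carrier H"
    and dec_add: "x \<in> carrier H \<Longrightarrow> y \<in> carrier H \<Longrightarrow> AE \<omega> in M. dec (x \<oplus> y) \<omega> = dec x \<omega> + dec y \<omega>"
    and dec_zero: "AE \<omega> in M. dec \<zero> \<omega> = 0"
    and dec_scale: "x \<in> carrier H \<Longrightarrow> AE \<omega> in M. dec (c \<odot>\<^bsub>H\<^esub> x) \<omega> = c * dec x \<omega>"
    and ip_dec: "x \<in> carrier H \<Longrightarrow> y \<in> carrier H \<Longrightarrow> ip H x y = (\<integral>\<omega>. dec x \<omega> * cnj (dec y \<omega>) \<partial>M)"
begin

lemma dec_measurable [measurable]: "x \<in> carrier H \<Longrightarrow> dec x \<in> borel_measurable M"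
  using dec_square_integrable by (simp add: square_integrable_def)

lemma abelian_group_H: "abelian_group H"
proof (rule abelian_groupI)
  fix x y z assume xyz: "x \<in> carrier H" "y \<in> carrier H" "z \<in> carrier H"
  show "(x \<oplus> y) \<oplus> z = x \<oplus> (y \<oplus> z)"
  proof (rule dec_inj)
    show "AE \<omega> in M. dec ((x \<oplus> y) \<oplus> z) \<omega> = dec (x \<oplus> (y \<oplus> z)) \<omega>"
      using dec_add[OF xyz(1,2)] dec_add[OF xyz(2,3)] dec_add[OF add_closed'[OF xyz(1,2)] xyz(3)]
        dec_add[OF xyz(1) add_closed'[OF xyz(2,3)]]
      by eventually_elim simp
  qed (use xyz in \<open>auto intro: add_closed'\<close>)
next
  fix x y assume xy: "x \<in> carrier H" "y \<in> carrier H"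
  show "x \<oplus> y \<in> carrier H" using xy by (rule add_closed')
  show "x \<oplus> y = y \<oplus> x"
  proof (rule dec_inj)
    show "AE \<omega> in M. dec (x \<oplus> y) \<omega> = dec (y \<oplus> x) \<omega>"
      using dec_add[OF xy] dec_add[OF xy(2,1)] by eventually_elim simp
  qed (use xy in \<open>auto intro: add_closed'\<close>)
next
  fix x assume x: "x \<in> carrier H"
  show "\<zero> \<oplus> x = x"
  proof (rule dec_inj)
    show "AE \<omega> in M. dec (\<zero> \<oplus> x) \<omega> = dec x \<omega>"
      using dec_add[OF zero_closed' x] dec_zero by eventually_elim simp
  qed (use x in \<open>auto intro: add_closed' zero_closed'\<close>)
  show "\<exists>y\<in>carrier H. y \<oplus> x = \<zero>"
  proof (intro bexI dec_inj)
    show "AE \<omega> in M. dec ((-1) \<odot>\<^bsub>H\<^esub> x \<oplus> x) \<omega> = dec \<zero> \<omega>"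
      using dec_add[OF scale_closed[OF x] x, of "-1"] dec_scale[OF x, of "-1"] dec_zero
      by eventually_elim simp
  qed (use x in \<open>auto intro: add_closed' zero_closed' scale_closed\<close>)
qed (rule zero_closed')

lemma module_H: "module (ring_of_type_algebra :: complex ring) H"
proof (rule moduleI)
  show "cring (ring_of_type_algebra :: complex ring)" by (rule cring_from_type_algebra)
  show "abelian_group H" by (rule abelian_group_H)
next
  fix a b :: complex and x assume x: "x \<in> carrier H"
  show "a \<odot>\<^bsub>H\<^esub> x \<in> carrier H" using x by (rule scale_closed)
  have "(a + b) \<odot>\<^bsub>H\<^esub> x = a \<odot>\<^bsub>H\<^esub> x \<oplus> b \<odot>\<^bsub>H\<^esub> x"
  proof (rule dec_inj)
    show "AE \<omega> in M. dec ((a + b) \<odot>\<^bsub>H\<^esub> x) \<omega> = dec (a \<odot>\<^bsub>H\<^esub> x \<oplus> b \<odot>\<^bsub>H\<^esub> x) \<omega>"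
      using dec_scale[OF x, of "a + b"] dec_scale[OF x, of a] dec_scale[OF x, of b]
        dec_add[OF scale_closed[OF x] scale_closed[OF x], of a b]
      by eventually_elim (simp add: algebra_simps)
  qed (use x in \<open>auto intro: add_closed' scale_closed\<close>)
  then show "(a \<oplus>\<^bsub>ring_of_type_algebra\<^esub> b) \<odot>\<^bsub>H\<^esub> x = a \<odot>\<^bsub>H\<^esub> x \<oplus> b \<odot>\<^bsub>H\<^esub> x"
    by (simp add: ring_of_type_algebra_def)
  have "(a * b) \<odot>\<^bsub>H\<^esub> x = a \<odot>\<^bsub>H\<^esub> (b \<odot>\<^bsub>H\<^esub> x)"
  proof (rule dec_inj)
    show "AE \<omega> in M. dec ((a * b) \<odot>\<^bsub>H\<^esub> x) \<omega> = dec (a \<odot>\<^bsub>H\<^esub> (b \<odot>\<^bsub>H\<^esub> x)) \<omega>"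
      using dec_scale[OF x, of "a * b"] dec_scale[OF scale_closed[OF x], of a b] dec_scale[OF x, of b]
      by eventually_elim (simp add: algebra_simps)
  qed (use x in \<open>auto intro: scale_closed\<close>)
  then show "(a \<otimes>\<^bsub>ring_of_type_algebra\<^esub> b) \<odot>\<^bsub>H\<^esub> x = a \<odot>\<^bsub>H\<^esub> (b \<odot>\<^bsub>H\<^esub> x)"
    by (simp add: ring_of_type_algebra_def)
  have "1 \<odot>\<^bsub>H\<^esub> x = x"
  proof (rule dec_inj)
    show "AE \<omega> in M. dec (1 \<odot>\<^bsub>H\<^esub> x) \<omega> = dec x \<omega>"
      using dec_scale[OF x, of 1] by eventually_elim simp
  qed (use x in \<open>auto intro: scale_closed\<close>)
  then show "\<one>\<^bsub>ring_of_type_algebra\<^esub> \<odot>\<^bsub>H\<^esub> x = x"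
    by (simp add: ring_of_type_algebra_def)
next
  fix a :: complex and x y assume x: "x \<in> carrier H" and y: "y \<in> carrier H"
  show "a \<odot>\<^bsub>H\<^esub> (x \<oplus> y) = a \<odot>\<^bsub>H\<^esub> x \<oplus> a \<odot>\<^bsub>H\<^esub> y"
  proof (rule dec_inj)
    show "AE \<omega> in M. dec (a \<odot>\<^bsub>H\<^esub> (x \<oplus> y)) \<omega> = dec (a \<odot>\<^bsub>H\<^esub> x \<oplus> a \<odot>\<^bsub>H\<^esub> y) \<omega>"
      using dec_scale[OF add_closed'[OF x y], of a] dec_scale[OF x, of a] dec_scale[OF y, of a]
        dec_add[OF x y] dec_add[OF scale_closed[OF x] scale_closed[OF y], of a a]
      by eventually_elim (simp add: algebra_simps)
  qed (use x y in \<open>auto intro: add_closed' scale_closed\<close>)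
qed

sublocale module "ring_of_type_algebra :: complex ring" H
  by (rule module_H)

lemma dec_minus:
  assumes x: "x \<in> carrier H" and y: "y \<in> carrier H"
  shows "AE \<omega> in M. dec (x \<ominus> y) \<omega> = dec x \<omega> - dec y \<omega>"
proof -
  have m: "\<ominus> y \<in> carrier H" "\<ominus> y \<oplus> y = \<zero>" using y by (auto simp: M.l_neg)
  show ?thesis
    using dec_add[OF x m(1)] dec_add[OF m(1) y] dec_zero unfolding m(2) a_minus_def
    by eventually_elim (simp add: eq_neg_iff_add_eq_0 algebra_simps)
qed

lemma ip_self: "x \<in> carrier H \<Longrightarrow> ip H x x = of_real ((L2_norm M (dec x))\<^sup>2)"
  by (simp add: ip_dec L2_norm_power2 complex_norm_square[symmetric] del: of_real_power)

lemma hnorm_eq: "x \<in> carrier H \<Longrightarrow> hnorm H x = L2_norm M (dec x)"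
  by (simp add: hnorm_def ip_self)

lemma hdist_eq:
  "x \<in> carrier H \<Longrightarrow> y \<in> carrier H \<Longrightarrow> hdist H x y = L2_norm M (\<lambda>\<omega>. dec x \<omega> - dec y \<omega>)"
  unfolding hdist_def using dec_minus[of x y]
  by (auto simp: hnorm_eq intro!: L2_norm_cong_AE)

sublocale Met: Metric_space "carrier H" "hdist H"
proof
  fix x y
  show "0 \<le> hdist H x y"
    by (cases "x \<in> carrier H \<and> y \<in> carrier H") (auto simp: hdist_eq, auto simp: hdist_def)
  show "hdist H x y = hdist H y x"
    using L2_norm_minus_commute[of M "dec x" "dec y"]
    by (cases "x \<in> carrier H \<and> y \<in> carrier H") (simp_all add: hdist_eq, auto simp: hdist_def)
next
  fix x y assume xy: "x \<in> carrier H" "y \<in> carrier H"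
  have "hdist H x y = 0 \<longleftrightarrow> (AE \<omega> in M. dec x \<omega> - dec y \<omega> = 0)"
    using xy by (simp add: hdist_eq L2_norm_eq_0_iff square_integrable_diff dec_square_integrable)
  also have "\<dots> \<longleftrightarrow> x = y" using dec_inj[OF xy] by auto
  finally show "hdist H x y = 0 \<longleftrightarrow> x = y" .
next
  fix x y z assume xyz: "x \<in> carrier H" "y \<in> carrier H" "z \<in> carrier H"
  have "L2_norm M (\<lambda>\<omega>. (dec x \<omega> - dec y \<omega>) + (dec y \<omega> - dec z \<omega>))
      \<le> L2_norm M (\<lambda>\<omega>. dec x \<omega> - dec y \<omega>) + L2_norm M (\<lambda>\<omega>. dec y \<omega> - dec z \<omega>)"
    using xyz by (intro L2_norm_triangle square_integrable_diff dec_square_integrable)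
  then show "hdist H x z \<le> hdist H x y + hdist H y z"
    using xyz by (simp add: hdist_eq)
qed

lemma limitin_iff:
  assumes "range s \<subseteq> carrier H" "x \<in> carrier H"
  shows "limitin (htopology H) s x sequentially \<longleftrightarrow> (\<lambda>n. hdist H (s n) x) \<longlonglongrightarrow> 0"
  using assms by (auto simp: Met.limitin_metric_dist_null range_subsetD)

theorem complex_hilbert_space: "complex_hilbert_space H"
proof (intro complex_hilbert_space.intro complex_hilbert_space_axioms.intro module_H)
  fix x y z assume xyz: "x \<in> carrier H" "y \<in> carrier H" "z \<in> carrier H"
  have [measurable]: "dec x \<in> borel_measurable M" "dec y \<in> borel_measurable M"
    "dec z \<in> borel_measurable M" "dec (x \<oplus> y) \<in> borel_measurable M"
    using xyz add_closed' by auto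
  have "ip H (x \<oplus> y) z = (\<integral>\<omega>. dec (x \<oplus> y) \<omega> * cnj (dec z \<omega>) \<partial>M)"
    using xyz by (simp add: ip_dec add_closed')
  also have "\<dots> = (\<integral>\<omega>. dec x \<omega> * cnj (dec z \<omega>) + dec y \<omega> * cnj (dec z \<omega>) \<partial>M)"
    by (rule integral_cong_AE)
      (use dec_add[OF xyz(1,2)] in \<open>auto simp: distrib_right elim!: eventually_mono\<close>)
  also have "\<dots> = ip H x z + ip H y z"
    unfolding ip_dec[OF xyz(1,3)] ip_dec[OF xyz(2,3)]
    by (intro Bochner_Integration.integral_add square_integrable_mult_cnj dec_square_integrable xyz)
  finally show "ip H (x \<oplus> y) z = ip H x z + ip H y z" .
next
  fix x y c assume xy: "x \<in> carrier H" "y \<in> carrier H"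
  have [measurable]: "dec x \<in> borel_measurable M" "dec y \<in> borel_measurable M"
    "dec (c \<odot>\<^bsub>H\<^esub> x) \<in> borel_measurable M"
    using xy scale_closed by auto
  have "(\<integral>\<omega>. dec (c \<odot>\<^bsub>H\<^esub> x) \<omega> * cnj (dec y \<omega>) \<partial>M) = (\<integral>\<omega>. c * (dec x \<omega> * cnj (dec y \<omega>)) \<partial>M)"
    by (rule integral_cong_AE) (use dec_scale[OF xy(1), of c] in \<open>auto elim!: eventually_mono\<close>)
  then have "ip H (c \<odot>\<^bsub>H\<^esub> x) y = (\<integral>\<omega>. c * (dec x \<omega> * cnj (dec y \<omega>)) \<partial>M)"
    using xy scale_closed by (simp add: ip_dec)
  then show "ip H (c \<odot>\<^bsub>H\<^esub> x) y = c * ip H x y"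
    using xy by (simp add: ip_dec)
next
  fix x y assume xy: "x \<in> carrier H" "y \<in> carrier H"
  have "(\<lambda>\<omega>. dec x \<omega> * cnj (dec y \<omega>)) = (\<lambda>\<omega>. cnj (dec y \<omega> * cnj (dec x \<omega>)))"
    by (simp add: fun_eq_iff mult.commute)
  then show "ip H x y = cnj (ip H y x)"
    unfolding ip_dec[OF xy] ip_dec[OF xy(2,1)]
    by (simp only: Bochner_Integration.integral_cnj)
next
  fix x assume x: "x \<in> carrier H" "x \<noteq> \<zero>"
  have "\<not> (AE \<omega> in M. dec x \<omega> = 0)"
  proof
    assume "AE \<omega> in M. dec x \<omega> = 0"
    then have "AE \<omega> in M. dec x \<omega> = dec \<zero> \<omega>" using dec_zero by eventually_elim simp
    then show False using dec_inj[OF x(1) zero_closed'] x(2) by simp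
  qed
  then have "L2_norm M (dec x) \<noteq> 0"
    using x by (simp add: L2_norm_eq_0_iff dec_square_integrable)
  then show "0 < Re (ip H x x)" using x by (simp add: ip_self)
next
  show "Met.mcomplete"
    unfolding Met.mcomplete_def
  proof (intro allI impI)
    fix s assume s: "Met.MCauchy s"
    then have sc: "s n \<in> carrier H" for n by (auto simp: Met.MCauchy_def)
    have C: "\<exists>N. \<forall>m\<ge>N. \<forall>n\<ge>N. L2_norm M (\<lambda>\<omega>. dec (s m) \<omega> - dec (s n) \<omega>) < e" if "0 < e" for e
    proof -
      have "\<forall>e>0. \<exists>N. \<forall>n n'. N \<le> n \<longrightarrow> N \<le> n' \<longrightarrow> hdist H (s n) (s n') < e"
        using s by (simp add: Met.MCauchy_def)
      with that obtain N where N: "\<forall>n n'. N \<le> n \<longrightarrow> N \<le> n' \<longrightarrow> hdist H (s n) (s n') < e"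
        by metis
      show ?thesis
        by (intro exI[of _ N] allI impI) (simp add: hdist_eq[OF sc sc, symmetric] N)
    qed
    obtain f where f: "square_integrable M f" "(\<lambda>n. L2_norm M (\<lambda>\<omega>. dec (s n) \<omega> - f \<omega>)) \<longlonglongrightarrow> 0"
      by (rule L2_complete[of M "\<lambda>n. dec (s n)", OF dec_square_integrable[OF sc] C])
    obtain x where x: "x \<in> carrier H" "AE \<omega> in M. dec x \<omega> = f \<omega>" using dec_surj[OF f(1)] by blast
    have [measurable]: "f \<in> borel_measurable M" using f(1) by (simp add: square_integrable_def)
    have "hdist H (s n) x = L2_norm M (\<lambda>\<omega>. dec (s n) \<omega> - f \<omega>)" for n
      unfolding hdist_eq[OF sc x(1)] using x sc
      by (intro L2_norm_cong_AE) (auto elim!: eventually_mono)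
    with f(2) have "limitin (htopology H) s x sequentially"
      using sc x by (subst limitin_iff) auto
    then show "\<exists>x. limitin (htopology H) s x sequentially" by blast
  qed
qed

text \<open>Truncations to sets exhausting the space converge in norm by dominated convergence. This one
  criterion serves twice: for finitely supported functions on the tree, and for functions
  living where an unbounded multiplier is bounded.\<close>

lemma closure_of_eq_carrier:
  assumes D: "D \<subseteq> carrier H"
    and approx: "\<And>x. x \<in> carrier H \<Longrightarrow> \<exists>A :: nat \<Rightarrow> 'x set. (\<forall>n. A n \<in> sets M) \<and>
        (AE \<omega> in M. \<forall>\<^sub>F n in sequentially. \<omega> \<in> A n) \<and>
        (\<forall>n. \<forall>y\<in>carrier H. (AE \<omega> in M. dec y \<omega> = indicator (A n) \<omega> * dec x \<omega>) \<longrightarrow> y \<in> D)"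
  shows "htopology H closure_of D = carrier H"
proof
  show "htopology H closure_of D \<subseteq> carrier H"
    using closure_of_subset_topspace[of "htopology H" D] by simp
next
  show "carrier H \<subseteq> htopology H closure_of D"
  proof
    fix x assume x: "x \<in> carrier H"
    obtain A :: "nat \<Rightarrow> 'x set" where A [measurable]: "\<And>n. A n \<in> sets M"
      and ev: "AE \<omega> in M. \<forall>\<^sub>F n in sequentially. \<omega> \<in> A n"
      and inD: "\<And>n y. y \<in> carrier H \<Longrightarrow> AE \<omega> in M. dec y \<omega> = indicator (A n) \<omega> * dec x \<omega> \<Longrightarrow> y \<in> D"
      using approx[OF x] by blast
    have sx: "square_integrable M (dec x)" using x by (rule dec_square_integrable)
    have [measurable]: "dec x \<in> borel_measurable M" using x by simp
    have sq: "square_integrable M (\<lambda>\<omega>. indicator (A n) \<omega> * dec x \<omega>)" for n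
      by (rule square_integrable_bound[OF sx]) (auto simp: indicator_def)
    have "\<exists>y\<in>carrier H. AE \<omega> in M. dec y \<omega> = indicator (A n) \<omega> * dec x \<omega>" for n
      using dec_surj[OF sq] .
    then obtain y where y: "\<And>n. y n \<in> carrier H" "\<And>n. AE \<omega> in M. dec (y n) \<omega> = indicator (A n) \<omega> * dec x \<omega>"
      by metis
    have "(\<lambda>n. \<integral>\<omega>. (cmod (indicator (A n) \<omega> * dec x \<omega> - dec x \<omega>))\<^sup>2 \<partial>M) \<longlonglongrightarrow> (\<integral>\<omega>. 0 \<partial>M)"
    proof (rule integral_dominated_convergence)
      show "integrable M (\<lambda>\<omega>. (cmod (dec x \<omega>))\<^sup>2)" using sx by (rule square_integrableD)
      show "AE \<omega> in M. (\<lambda>n. (cmod (indicator (A n) \<omega> * dec x \<omega> - dec x \<omega>))\<^sup>2) \<longlonglongrightarrow> 0"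
        using ev
      proof eventually_elim
        case (elim \<omega>)
        then have "\<forall>\<^sub>F n in sequentially. (cmod (indicator (A n) \<omega> * dec x \<omega> - dec x \<omega>))\<^sup>2 = 0"
          by eventually_elim simp
        then show ?case by (rule tendsto_eventually)
      qed
    qed (auto simp: indicator_def)
    from tendsto_real_sqrt[OF this]
    have "(\<lambda>n. L2_norm M (\<lambda>\<omega>. indicator (A n) \<omega> * dec x \<omega> - dec x \<omega>)) \<longlonglongrightarrow> 0"
      by (simp add: L2_norm_def)
    moreover have "hdist H (y n) x = L2_norm M (\<lambda>\<omega>. indicator (A n) \<omega> * dec x \<omega> - dec x \<omega>)" for n
      unfolding hdist_eq[OF y(1) x] using y(1)[of n] y(2)[of n]
      by (intro L2_norm_cong_AE) (auto elim!: eventually_mono)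
    ultimately have lim: "(\<lambda>n. hdist H (y n) x) \<longlonglongrightarrow> 0" by simp
    show "x \<in> htopology H closure_of D"
      unfolding Met.metric_closure_of
    proof (intro CollectI conjI allI impI x)
      fix r :: real assume "0 < r"
      then obtain n where "hdist H (y n) x < r"
        using order_tendstoD(2)[OF lim \<open>0 < r\<close>] by (auto simp: eventually_sequentially)
      then have "y n \<in> Met.mball x r"
        using y(1)[of n] x Met.commute[of x "y n"] by simp
      moreover have "y n \<in> D" by (rule inD[OF y(1) y(2)])
      ultimately show "\<exists>y\<in>D. y \<in> Met.mball x r" by blast
    qed
  qed
qed

lemma continuous_ip:
  assumes v: "v \<in> carrier H"
  shows "continuous_map (htopology H) euclidean (\<lambda>x. ip H v x)"
proof -
  have "continuous_map (htopology H) (Metric_space.mtopology (UNIV :: complex set) dist) (\<lambda>x. ip H v x)"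
    unfolding Met.metric_continuous_map[OF Met_TC.Metric_space_axioms]
  proof (intro conjI ballI allI impI)
    fix a e assume a: "a \<in> carrier H" and e: "0 < (e::real)"
    let ?d = "e / (L2_norm M (dec v) + 1)"
    have p: "0 < L2_norm M (dec v) + 1" using L2_norm_nonneg[of M "dec v"] by linarith
    have "dist (ip H v a) (ip H v x) < e" if x: "x \<in> carrier H" "hdist H a x < ?d" for x
    proof -
      have sq: "square_integrable M (dec v)" "square_integrable M (\<lambda>\<omega>. dec a \<omega> - dec x \<omega>)"
        using a v x by (auto intro: dec_square_integrable)
      have "ip H v a - ip H v x = (\<integral>\<omega>. dec v \<omega> * cnj (dec a \<omega> - dec x \<omega>) \<partial>M)"
        using a v x(1) square_integrable_mult_cnj[OF sq(1) dec_square_integrable[OF a]]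
          square_integrable_mult_cnj[OF sq(1) dec_square_integrable[OF x(1)]]
        by (simp add: ip_dec right_diff_distrib)
      then have "dist (ip H v a) (ip H v x) \<le> L2_norm M (dec v) * hdist H a x"
        using L2_Cauchy_Schwarz[OF sq] a x by (simp add: dist_norm hdist_eq)
      also have "\<dots> \<le> (L2_norm M (dec v) + 1) * hdist H a x"
        by (intro mult_right_mono) auto
      also have "\<dots> < e" using x(2) p by (simp add: field_simps)
      finally show ?thesis .
    qed
    moreover have "0 < ?d" using e p by simp
    ultimately show "\<exists>d>0. \<forall>x. x \<in> carrier H \<and> hdist H a x < d \<longrightarrow> dist (ip H v a) (ip H v x) < e"
      by blast
  qed simp
  then show ?thesis by simp
qed

text \<open>An adjoint is an intersection of equalizers of continuous functionals on \<open>H \<times> H\<close>. It is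
  through this lemma that the closedness of normal operators is obtained: each of them is exhibited
  as an adjoint.\<close>

lemma closed_adjoint:
  assumes A: "A \<subseteq> carrier H \<times> carrier H"
  shows "closed_operator H (adjoint_op H A)"
proof -
  let ?X = "prod_topology (htopology H) (htopology H)"
  have top: "topspace ?X = carrier H \<times> carrier H" by simp
  have *: "closedin ?X {p \<in> topspace ?X. ip H v (fst p) = ip H u (snd p)}"
    if "(u, v) \<in> A" for u v
  proof (rule closedin_continuous_maps_eq)
    show "Hausdorff_space (euclidean :: complex topology)" by simp
    have uv: "u \<in> carrier H" "v \<in> carrier H" using A that by auto
    show "continuous_map ?X euclidean (\<lambda>p. ip H v (fst p))"
      using continuous_map_compose[OF continuous_map_fst continuous_ip[OF uv(2)]] by (simp add: o_def)
    show "continuous_map ?X euclidean (\<lambda>p. ip H u (snd p))"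
      using continuous_map_compose[OF continuous_map_snd continuous_ip[OF uv(1)]] by (simp add: o_def)
  qed
  have eq: "adjoint_op H A = topspace ?X \<inter> (\<Inter>(u, v)\<in>A. {p \<in> topspace ?X. ip H v (fst p) = ip H u (snd p)})"
    unfolding top adjoint_op_def by auto
  have "closedin ?X (adjoint_op H A)"
  proof (cases "A = {}")
    case True
    then show ?thesis unfolding eq using closedin_topspace[of ?X] by simp
  next
    case False
    show ?thesis unfolding eq
      by (intro closedin_Int closedin_topspace closedin_INT False) (use * in auto)
  qed
  then show ?thesis by (simp add: closed_operator_def)
qed

end

section \<open>Normality of weighted composition operators\<close>

text \<open>If \<open>T\<close> is an invertible measure preserving map, composition with \<open>T\<close> is unitary, and it commutes
  with multiplication by a \<open>T\<close>-invariant real function \<open>w\<close>. The product of the two is therefore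
  normal, on its maximal domain, with adjoint of the same kind for the inverse map \<open>T'\<close>.\<close>

locale weighted_composition = L2_model M H dec
  for M :: "'x measure" and H :: "'e chilbert" (structure) and dec :: "'e \<Rightarrow> 'x \<Rightarrow> complex" +
  fixes T T' :: "'x \<Rightarrow> 'x" and w :: "'x \<Rightarrow> real"
  assumes T [measurable]: "T \<in> measurable M M" and T' [measurable]: "T' \<in> measurable M M"
    and T'_T: "\<omega> \<in> space M \<Longrightarrow> T' (T \<omega>) = \<omega>" and T_T': "\<omega> \<in> space M \<Longrightarrow> T (T' \<omega>) = \<omega>"
    and distr_T: "distr M M T = M"
    and w [measurable]: "w \<in> borel_measurable M"
    and w_T: "\<omega> \<in> space M \<Longrightarrow> w (T \<omega>) = w \<omega>"
begin

definition wcomp :: "('e \<times> 'e) set" where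
  "wcomp = {(x, y) \<in> carrier H \<times> carrier H. AE \<omega> in M. dec y \<omega> = of_real (w \<omega>) * dec x (T \<omega>)}"

text \<open>The hypotheses are symmetric in \<open>T\<close> and \<open>T'\<close>; each fact about \<open>T\<close> below is also used
  for \<open>T'\<close>.\<close>

lemma inverse_weighted_composition: "weighted_composition M H dec T' T w"
proof
  show "distr M M T' = M"
  proof -
    have "distr M M T' = distr (distr M M T) M T'" by (simp add: distr_T)
    also have "\<dots> = distr M M (\<lambda>\<omega>. T' (T \<omega>))" by (simp add: distr_distr o_def)
    also have "\<dots> = distr M M (\<lambda>\<omega>. \<omega>)" by (rule distr_cong) (auto simp: T'_T)
    finally show ?thesis by simp
  qed
  show "w (T' \<omega>) = w \<omega>" if "\<omega> \<in> space M" for \<omega>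
    using w_T[of "T' \<omega>"] T_T'[OF that] measurable_space[OF T' that] by simp
qed (auto simp: T'_T T_T')

lemma AE_comp: "AE \<omega> in M. P \<omega> \<Longrightarrow> AE \<omega> in M. P (T \<omega>)"
  using AE_distrD[OF T, of P] unfolding distr_T by blast

lemma integral_comp:
  fixes f :: "'x \<Rightarrow> complex"
  shows "f \<in> borel_measurable M \<Longrightarrow> (\<integral>\<omega>. f (T \<omega>) \<partial>M) = (\<integral>\<omega>. f \<omega> \<partial>M)"
  using integral_distr[OF T, of f] by (simp add: distr_T)

lemma square_integrable_comp:
  assumes "square_integrable M f"
  shows "square_integrable M (\<lambda>\<omega>. f (T \<omega>))"
proof -
  have [measurable]: "f \<in> borel_measurable M" using assms by (simp add: square_integrable_def)
  have "(\<integral>\<^sup>+ \<omega>. ennreal ((cmod (f (T \<omega>)))\<^sup>2) \<partial>M) = (\<integral>\<^sup>+ \<omega>. ennreal ((cmod (f \<omega>))\<^sup>2) \<partial>M)"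
    using nn_integral_distr[OF T, of "\<lambda>\<omega>. ennreal ((cmod (f \<omega>))\<^sup>2)"] by (simp add: distr_T)
  with assms show ?thesis by (simp add: square_integrable_iff_nn)
qed

lemma wcomp_subset: "wcomp \<subseteq> carrier H \<times> carrier H"
  by (auto simp: wcomp_def)

lemma in_wcomp_dest:
  "(x, y) \<in> wcomp \<Longrightarrow> x \<in> carrier H \<and> y \<in> carrier H \<and> (AE \<omega> in M. dec y \<omega> = of_real (w \<omega>) * dec x (T \<omega>))"
  by (simp add: wcomp_def)

lemma Domain_wcompI:
  assumes x: "x \<in> carrier H" and sq: "square_integrable M (\<lambda>\<omega>. of_real (w \<omega>) * dec x (T \<omega>))"
  obtains y where "(x, y) \<in> wcomp"
  using dec_surj[OF sq] x by (auto simp: wcomp_def)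

lemma square_integrable_w_bounded:
  assumes "square_integrable M f"
  shows "square_integrable M (\<lambda>\<omega>. of_real (w \<omega>) * (indicator {\<omega> \<in> space M. \<bar>w \<omega>\<bar> \<le> real n} \<omega> * f \<omega>))"
proof (rule square_integrable_bound[OF square_integrable_scale[OF assms, of "of_nat n"]])
  have [measurable]: "f \<in> borel_measurable M" using assms by (simp add: square_integrable_def)
  show "(\<lambda>\<omega>. complex_of_real (w \<omega>) * (indicator {\<omega> \<in> space M. \<bar>w \<omega>\<bar> \<le> real n} \<omega> * f \<omega>)) \<in> borel_measurable M"
    by measurable
  show "AE \<omega> in M. cmod (complex_of_real (w \<omega>) * (indicator {\<omega> \<in> space M. \<bar>w \<omega>\<bar> \<le> real n} \<omega> * f \<omega>))
      \<le> cmod (of_nat n * f \<omega>)"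
    by (rule AE_I2) (auto simp: norm_mult indicator_def intro: mult_right_mono)
qed

text \<open>Functions supported where \<open>|w| \<le> n\<close> lie in the domain. They are the test functions for both the
  density of the domain and the computation of the adjoint.\<close>

lemma Domain_wcomp_truncation:
  assumes x: "square_integrable M f" and u: "u \<in> carrier H"
    and eq: "AE \<omega> in M. dec u \<omega> = indicator {\<omega> \<in> space M. \<bar>w \<omega>\<bar> \<le> real n} \<omega> * f \<omega>"
  obtains v where "(u, v) \<in> wcomp"
proof (rule Domain_wcompI[OF u])
  have [measurable]: "dec u \<in> borel_measurable M" "f \<in> borel_measurable M"
    using x u by (auto simp: square_integrable_def)
  have "square_integrable M (\<lambda>\<omega>. of_real (w (T \<omega>)) * (indicator {\<omega> \<in> space M. \<bar>w \<omega>\<bar> \<le> real n} (T \<omega>) * f (T \<omega>)))"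
    using square_integrable_comp[OF square_integrable_w_bounded[OF x, of n]] .
  then show "square_integrable M (\<lambda>\<omega>. of_real (w \<omega>) * dec u (T \<omega>))"
  proof (rule square_integrable_bound)
    show "AE \<omega> in M. cmod (complex_of_real (w \<omega>) * dec u (T \<omega>))
        \<le> cmod (complex_of_real (w (T \<omega>)) * (indicator {\<omega> \<in> space M. \<bar>w \<omega>\<bar> \<le> real n} (T \<omega>) * f (T \<omega>)))"
      using AE_comp[OF eq] AE_space by eventually_elim (simp add: w_T)
  qed simp
qed

lemma wcomp_densely_defined: "densely_defined H wcomp"
  unfolding densely_defined_def
proof (rule closure_of_eq_carrier)
  show "Domain wcomp \<subseteq> carrier H" using wcomp_subset by auto
  fix x assume x: "x \<in> carrier H"
  define A where "A n = {\<omega> \<in> space M. \<bar>w \<omega>\<bar> \<le> real n}" for n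
  have "A n \<in> sets M" for n unfolding A_def by measurable
  moreover have "AE \<omega> in M. \<forall>\<^sub>F n in sequentially. \<omega> \<in> A n"
  proof (rule AE_I2)
    fix \<omega> assume "\<omega> \<in> space M"
    moreover obtain N where "\<bar>w \<omega>\<bar> \<le> real N" using real_arch_simple by blast
    ultimately show "\<forall>\<^sub>F n in sequentially. \<omega> \<in> A n"
      unfolding eventually_sequentially A_def by (intro exI[of _ N]) auto
  qed
  moreover have "u \<in> Domain wcomp"
    if "u \<in> carrier H" "AE \<omega> in M. dec u \<omega> = indicator (A n) \<omega> * dec x \<omega>" for n u
    using Domain_wcomp_truncation[OF dec_square_integrable[OF x] that[unfolded A_def]] by blast
  ultimately show "\<exists>A :: nat \<Rightarrow> 'x set. (\<forall>n. A n \<in> sets M) \<and>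
        (AE \<omega> in M. \<forall>\<^sub>F n in sequentially. \<omega> \<in> A n) \<and>
        (\<forall>n. \<forall>y\<in>carrier H. (AE \<omega> in M. dec y \<omega> = indicator (A n) \<omega> * dec x \<omega>) \<longrightarrow> y \<in> Domain wcomp)"
    by (intro exI[of _ A]) blast
qed

lemma wcomp_linear: "linear_operator H wcomp"
  unfolding linear_operator_def
proof (intro conjI allI impI wcomp_subset)
  show "single_valued wcomp"
  proof (rule single_valuedI)
    fix x y z assume xy: "(x, y) \<in> wcomp" and xz: "(x, z) \<in> wcomp"
    note 1 = in_wcomp_dest[OF xy] note 2 = in_wcomp_dest[OF xz]
    have "AE \<omega> in M. dec y \<omega> = dec z \<omega>"
      using conjunct2[OF conjunct2[OF 1]] conjunct2[OF conjunct2[OF 2]] by eventually_elim simp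
    with 1 2 show "y = z" by (intro dec_inj) auto
  qed
  have "AE \<omega> in M. dec \<zero> \<omega> = of_real (w \<omega>) * dec \<zero> (T \<omega>)"
    using dec_zero AE_comp[OF dec_zero] by eventually_elim simp
  then show "(\<zero>, \<zero>) \<in> wcomp" by (simp add: wcomp_def zero_closed')
next
  fix x y x' y' assume xy: "(x, y) \<in> wcomp" and xy': "(x', y') \<in> wcomp"
  note 1 = in_wcomp_dest[OF xy] note 2 = in_wcomp_dest[OF xy']
  have c: "x \<in> carrier H" "y \<in> carrier H" "x' \<in> carrier H" "y' \<in> carrier H" using 1 2 by auto
  have "AE \<omega> in M. dec (y \<oplus> y') \<omega> = of_real (w \<omega>) * dec (x \<oplus> x') (T \<omega>)"
    using conjunct2[OF conjunct2[OF 1]] conjunct2[OF conjunct2[OF 2]] dec_add[OF c(2,4)]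
      AE_comp[OF dec_add[OF c(1,3)]]
    by eventually_elim (simp add: algebra_simps)
  then show "(x \<oplus> x', y \<oplus> y') \<in> wcomp" using c by (simp add: wcomp_def add_closed')
next
  fix c x y assume xy: "(x, y) \<in> wcomp"
  note 1 = in_wcomp_dest[OF xy]
  have c: "x \<in> carrier H" "y \<in> carrier H" using 1 by auto
  have "AE \<omega> in M. dec (c \<odot>\<^bsub>H\<^esub> y) \<omega> = of_real (w \<omega>) * dec (c \<odot>\<^bsub>H\<^esub> x) (T \<omega>)"
    using conjunct2[OF conjunct2[OF 1]] dec_scale[OF c(2), of c] AE_comp[OF dec_scale[OF c(1), of c]]
    by eventually_elim (simp add: algebra_simps)
  then show "(c \<odot>\<^bsub>H\<^esub> x, c \<odot>\<^bsub>H\<^esub> y) \<in> wcomp" using c by (simp add: wcomp_def scale_closed)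
qed

text \<open>A change of variables by \<open>T\<close> shows that the operator of \<open>T'\<close> is contained in the adjoint.
  Conversely, let \<open>(x, y)\<close> belong to the adjoint and put \<open>g = y - w (x \<circ> T')\<close>. Nothing is known about
  the integrability of \<open>g\<close>, but its truncations to \<open>|w| \<le> n\<close> lie in the domain, and testing the adjoint
  relation with them shows that their norms vanish.\<close>

lemma adjoint_wcomp:
  "adjoint_op H wcomp = weighted_composition.wcomp M H dec T' w"
proof -
  interpret inv: weighted_composition M H dec T' T w by (rule inverse_weighted_composition)
  have moved: "ip H v x = (\<integral>\<omega>. dec u \<omega> * cnj (of_real (w \<omega>) * dec x (T' \<omega>)) \<partial>M)"
    if uv: "(u, v) \<in> wcomp" and x: "x \<in> carrier H" for u v x
  proof -
    note 1 = in_wcomp_dest[OF uv]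
    have [measurable]: "dec u \<in> borel_measurable M" "dec v \<in> borel_measurable M" "dec x \<in> borel_measurable M"
      using 1 x by auto
    have "ip H v x = (\<integral>\<omega>. dec v \<omega> * cnj (dec x \<omega>) \<partial>M)" using 1 x by (simp add: ip_dec)
    also have "\<dots> = (\<integral>\<omega>. dec u (T \<omega>) * cnj (of_real (w (T \<omega>)) * dec x (T' (T \<omega>))) \<partial>M)"
    proof (rule integral_cong_AE)
      show "AE \<omega> in M. dec v \<omega> * cnj (dec x \<omega>) = dec u (T \<omega>) * cnj (of_real (w (T \<omega>)) * dec x (T' (T \<omega>)))"
        using conjunct2[OF conjunct2[OF 1]] AE_space by eventually_elim (simp add: w_T T'_T)
    qed measurable
    also have "\<dots> = (\<integral>\<omega>. dec u \<omega> * cnj (of_real (w \<omega>) * dec x (T' \<omega>)) \<partial>M)"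
      by (rule integral_comp) measurable
    finally show ?thesis .
  qed
  show ?thesis
  proof (intro Set.set_eqI iffI; clarify)
    fix x y assume xy: "(x, y) \<in> inv.wcomp"
    note 1 = inv.in_wcomp_dest[OF xy]
    have "ip H v x = ip H u y" if uv: "(u, v) \<in> wcomp" for u v
    proof -
      have [measurable]: "dec u \<in> borel_measurable M" "dec y \<in> borel_measurable M" "dec x \<in> borel_measurable M"
        using 1 in_wcomp_dest[OF uv] by auto
      have "(\<integral>\<omega>. dec u \<omega> * cnj (of_real (w \<omega>) * dec x (T' \<omega>)) \<partial>M) = (\<integral>\<omega>. dec u \<omega> * cnj (dec y \<omega>) \<partial>M)"
        by (rule integral_cong_AE) (use conjunct2[OF conjunct2[OF 1]] in \<open>auto elim!: eventually_mono\<close>)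
      then show ?thesis using moved[OF uv] 1 in_wcomp_dest[OF uv] by (simp add: ip_dec)
    qed
    with 1 show "(x, y) \<in> adjoint_op H wcomp" by (auto simp: adjoint_op_def)
  next
    fix x y assume "(x, y) \<in> adjoint_op H wcomp"
    then have c: "x \<in> carrier H" "y \<in> carrier H" and adj: "\<And>u v. (u, v) \<in> wcomp \<Longrightarrow> ip H v x = ip H u y"
      by (auto simp: adjoint_op_def)
    have [measurable]: "dec x \<in> borel_measurable M" "dec y \<in> borel_measurable M" using c by auto
    define g where "g \<omega> = dec y \<omega> - of_real (w \<omega>) * dec x (T' \<omega>)" for \<omega>
    have [measurable]: "g \<in> borel_measurable M" unfolding g_def by measurable
    define A where "A n = {\<omega> \<in> space M. \<bar>w \<omega>\<bar> \<le> real n}" for n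
    have [measurable]: "A n \<in> sets M" for n unfolding A_def by measurable
    have sqx: "square_integrable M (\<lambda>\<omega>. of_real (w \<omega>) * (indicator (A n) \<omega> * dec x (T' \<omega>)))" for n
      unfolding A_def by (intro square_integrable_w_bounded inv.square_integrable_comp dec_square_integrable c)
    have sqy: "square_integrable M (\<lambda>\<omega>. indicator (A n) \<omega> * dec y \<omega>)" for n
      by (rule square_integrable_bound[OF dec_square_integrable[OF c(2)]]) (auto simp: indicator_def)
    have sq: "square_integrable M (\<lambda>\<omega>. indicator (A n) \<omega> * g \<omega>)" for n
    proof -
      have "(\<lambda>\<omega>. indicator (A n) \<omega> * dec y \<omega> - of_real (w \<omega>) * (indicator (A n) \<omega> * dec x (T' \<omega>)))
          = (\<lambda>\<omega>. indicator (A n) \<omega> * g \<omega>)"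
        by (auto simp: g_def algebra_simps)
      with square_integrable_diff[OF sqy sqx, of n n] show ?thesis by simp
    qed
    have zero: "AE \<omega> in M. indicator (A n) \<omega> * g \<omega> = 0" for n
    proof -
      obtain u where u: "u \<in> carrier H" "AE \<omega> in M. dec u \<omega> = indicator (A n) \<omega> * g \<omega>"
        using dec_surj[OF sq] by blast
      have [measurable]: "dec u \<in> borel_measurable M" using u by simp
      have u2: "AE \<omega> in M. dec u \<omega> = indicator {\<omega> \<in> space M. \<bar>w \<omega>\<bar> \<le> real n} \<omega> * (indicator (A n) \<omega> * g \<omega>)"
        using u(2) by eventually_elim (auto simp: A_def indicator_def)
      obtain v where uv: "(u, v) \<in> wcomp"
        by (rule Domain_wcomp_truncation[OF sq u(1) u2])
      have squ: "square_integrable M (dec u)" using u(1) by (rule dec_square_integrable)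
      have "(\<integral>\<omega>. dec u \<omega> * cnj (of_real (w \<omega>) * dec x (T' \<omega>)) \<partial>M) = (\<integral>\<omega>. dec u \<omega> * cnj (dec y \<omega>) \<partial>M)"
        using adj[OF uv] moved[OF uv c(1)] u(1) c by (simp add: ip_dec)
      moreover have "(\<integral>\<omega>. dec u \<omega> * cnj (of_real (w \<omega>) * dec x (T' \<omega>)) \<partial>M)
          = (\<integral>\<omega>. dec u \<omega> * cnj (of_real (w \<omega>) * (indicator (A n) \<omega> * dec x (T' \<omega>))) \<partial>M)"
        by (rule integral_cong_AE) (use u(2) in \<open>auto elim!: eventually_mono simp: indicator_def\<close>)
      moreover have "(\<integral>\<omega>. dec u \<omega> * cnj (dec y \<omega>) \<partial>M) = (\<integral>\<omega>. dec u \<omega> * cnj (indicator (A n) \<omega> * dec y \<omega>) \<partial>M)"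
        by (rule integral_cong_AE) (use u(2) in \<open>auto elim!: eventually_mono simp: indicator_def\<close>)
      ultimately have "(\<integral>\<omega>. dec u \<omega> * cnj (indicator (A n) \<omega> * dec y \<omega>)
           - dec u \<omega> * cnj (of_real (w \<omega>) * (indicator (A n) \<omega> * dec x (T' \<omega>))) \<partial>M) = 0"
        by (subst Bochner_Integration.integral_diff) (intro square_integrable_mult_cnj squ sqx sqy | simp)+
      moreover have "(\<integral>\<omega>. dec u \<omega> * cnj (indicator (A n) \<omega> * dec y \<omega>)
           - dec u \<omega> * cnj (of_real (w \<omega>) * (indicator (A n) \<omega> * dec x (T' \<omega>))) \<partial>M)
          = (\<integral>\<omega>. dec u \<omega> * cnj (dec u \<omega>) \<partial>M)"
      proof (rule integral_cong_AE)
        show "AE \<omega> in M. dec u \<omega> * cnj (indicator (A n) \<omega> * dec y \<omega>)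
             - dec u \<omega> * cnj (of_real (w \<omega>) * (indicator (A n) \<omega> * dec x (T' \<omega>)))
            = dec u \<omega> * cnj (dec u \<omega>)"
          using u(2)
        proof eventually_elim
          case (elim \<omega>)
          show ?case
            unfolding elim by (cases "\<omega> \<in> A n") (simp_all add: g_def right_diff_distrib)
        qed
      qed measurable
      ultimately have "ip H u u = 0" using u(1) by (simp add: ip_dec)
      then have "L2_norm M (dec u) = 0" using u(1) by (simp add: ip_self)
      then have "AE \<omega> in M. dec u \<omega> = 0" using L2_norm_eq_0_iff[OF squ] by simp
      with u(2) show ?thesis by eventually_elim simp
    qed
    have "AE \<omega> in M. \<forall>n. indicator (A n) \<omega> * g \<omega> = 0" unfolding AE_all_countable using zero by blast
    then have "AE \<omega> in M. dec y \<omega> = of_real (w \<omega>) * dec x (T' \<omega>)"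
      using AE_space
    proof eventually_elim
      case (elim \<omega>)
      obtain n where "\<bar>w \<omega>\<bar> \<le> real n" using real_arch_simple by blast
      with elim have "\<omega> \<in> A n" by (simp add: A_def)
      with elim(1)[rule_format, of n] have "g \<omega> = 0" by simp
      then show ?case by (simp add: g_def)
    qed
    with c show "(x, y) \<in> inv.wcomp" by (simp add: inv.wcomp_def)
  qed
qed

text \<open>The right-hand side does not mention \<open>T\<close>. Exchanging \<open>T\<close> and \<open>T'\<close> thus gives the commutation of
  the operator with its adjoint, equality of domains included.\<close>

lemma wcomp_O_inverse:
  "wcomp O weighted_composition.wcomp M H dec T' w =
     {(x, z) \<in> carrier H \<times> carrier H. square_integrable M (\<lambda>\<omega>. of_real (w \<omega>) * dec x \<omega>) \<and>
        (AE \<omega> in M. dec z \<omega> = of_real ((w \<omega>)\<^sup>2) * dec x \<omega>)}" (is "?L = ?R")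
proof -
  interpret inv: weighted_composition M H dec T' T w by (rule inverse_weighted_composition)
  show ?thesis
  proof (intro Set.set_eqI iffI)
    fix p assume "p \<in> ?L"
    then obtain x y z where p: "p = (x, z)" and xy: "(x, y) \<in> wcomp" and yz: "(y, z) \<in> inv.wcomp" by auto
    note 1 = in_wcomp_dest[OF xy] note 2 = inv.in_wcomp_dest[OF yz]
    have [measurable]: "dec x \<in> borel_measurable M" "dec y \<in> borel_measurable M" using 1 2 by auto
    have 3: "AE \<omega> in M. dec y (T' \<omega>) = of_real (w \<omega>) * dec x \<omega>"
      using inv.AE_comp[OF conjunct2[OF conjunct2[OF 1]]] AE_space
      by eventually_elim (simp add: inv.w_T T_T')
    have "square_integrable M (\<lambda>\<omega>. of_real (w \<omega>) * dec x \<omega>)"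
    proof (rule square_integrable_bound)
      show "square_integrable M (\<lambda>\<omega>. dec y (T' \<omega>))"
        using 1 by (intro inv.square_integrable_comp dec_square_integrable) simp
      show "AE \<omega> in M. cmod (complex_of_real (w \<omega>) * dec x \<omega>) \<le> cmod (dec y (T' \<omega>))"
        using 3 by eventually_elim simp
    qed measurable
    moreover have "AE \<omega> in M. dec z \<omega> = of_real ((w \<omega>)\<^sup>2) * dec x \<omega>"
      using 3 conjunct2[OF conjunct2[OF 2]] by eventually_elim (simp add: power2_eq_square)
    ultimately show "p \<in> ?R" using 1 2 p by simp
  next
    fix p assume "p \<in> ?R"
    then obtain x z where p: "p = (x, z)" and c: "x \<in> carrier H" "z \<in> carrier H"
      and sq: "square_integrable M (\<lambda>\<omega>. of_real (w \<omega>) * dec x \<omega>)"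
      and z: "AE \<omega> in M. dec z \<omega> = of_real ((w \<omega>)\<^sup>2) * dec x \<omega>" by auto
    have [measurable]: "dec x \<in> borel_measurable M" using c by auto
    have "square_integrable M (\<lambda>\<omega>. of_real (w \<omega>) * dec x (T \<omega>))"
    proof (rule square_integrable_bound[OF square_integrable_comp[OF sq]])
      show "AE \<omega> in M. cmod (complex_of_real (w \<omega>) * dec x (T \<omega>)) \<le> cmod (complex_of_real (w (T \<omega>)) * dec x (T \<omega>))"
        using AE_space by eventually_elim (simp add: w_T)
    qed measurable
    then obtain y where xy: "(x, y) \<in> wcomp" by (rule Domain_wcompI[OF c(1)])
    note 1 = in_wcomp_dest[OF xy]
    have "AE \<omega> in M. dec z \<omega> = of_real (w \<omega>) * dec y (T' \<omega>)"
      using inv.AE_comp[OF conjunct2[OF conjunct2[OF 1]]] AE_space z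
      by eventually_elim (simp add: inv.w_T T_T' power2_eq_square)
    then have "(y, z) \<in> inv.wcomp" using 1 c by (simp add: inv.wcomp_def)
    with xy p show "p \<in> ?L" by auto
  qed
qed

theorem wcomp_normal: "normal_operator H wcomp"
proof -
  interpret inv: weighted_composition M H dec T' T w by (rule inverse_weighted_composition)
  have "wcomp = adjoint_op H inv.wcomp" using inv.adjoint_wcomp by simp
  then have "closed_operator H wcomp" using closed_adjoint[OF inv.wcomp_subset] by simp
  moreover have "wcomp O inv.wcomp = inv.wcomp O wcomp"
    using wcomp_O_inverse inv.wcomp_O_inverse by simp
  ultimately show ?thesis
    by (simp add: normal_operator_def wcomp_linear wcomp_densely_defined adjoint_wcomp)
qed

end

section \<open>The two models: \<open>\<ell>\<^sup>2\<close> and \<open>L\<^sup>2\<close>\<close>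

lemma square_integrable_count_space:
  "square_integrable (count_space V) f \<longleftrightarrow> (\<lambda>v. (cmod (f v))\<^sup>2) summable_on V"
  using abs_summable_equivalent[of "\<lambda>v. (cmod (f v))\<^sup>2" V]
  by (simp add: square_integrable_def abs_summable_on_def)

lemma integral_count_space_eq_infsum:
  fixes f :: "'v \<Rightarrow> complex"
  assumes "integrable (count_space V) f"
  shows "(\<integral>v. f v \<partial>count_space V) = (\<Sum>\<^sub>\<infinity>v\<in>V. f v)"
  using infsetsum_infsum[of f V] assms by (simp add: infsetsum_def abs_summable_on_def)

lemma L2_model_ell2: "L2_model (count_space V) (ell2 V) (\<lambda>f. f)"
proof
  fix x y :: "'a \<Rightarrow> complex" and c :: complex
  assume x: "x \<in> carrier (ell2 V)"
  show sx: "square_integrable (count_space V) x"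
    using x by (simp add: ell2_def square_integrable_count_space)
  show "c \<odot>\<^bsub>ell2 V\<^esub> x \<in> carrier (ell2 V)"
    using x square_integrable_scale[OF sx, of c]
    by (simp add: ell2_def square_integrable_count_space)
  show "AE v in count_space V. (c \<odot>\<^bsub>ell2 V\<^esub> x) v = c * x v"
    by (simp add: ell2_def)
  assume y: "y \<in> carrier (ell2 V)"
  then have sy: "square_integrable (count_space V) y"
    by (simp add: ell2_def square_integrable_count_space)
  show "x \<oplus>\<^bsub>ell2 V\<^esub> y \<in> carrier (ell2 V)"
    using x y square_integrable_add[OF sx sy]
    by (simp add: ell2_def square_integrable_count_space)
  show "AE v in count_space V. (x \<oplus>\<^bsub>ell2 V\<^esub> y) v = x v + y v"
    by (simp add: ell2_def)
  show "ip (ell2 V) x y = (\<integral>v. x v * cnj (y v) \<partial>count_space V)"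
    using integral_count_space_eq_infsum[OF square_integrable_mult_cnj[OF sx sy]]
    by (simp add: ell2_def)
  assume "AE v in count_space V. x v = y v"
  then have "\<forall>v\<in>V. x v = y v" by (simp add: AE_count_space)
  moreover have "x v = y v" if "v \<notin> V" for v using x y that by (simp add: ell2_def)
  ultimately show "x = y" by (intro ext) blast
next
  fix f :: "'a \<Rightarrow> complex"
  assume f: "square_integrable (count_space V) f"
  show "\<exists>x\<in>carrier (ell2 V). AE v in count_space V. x v = f v"
  proof
    have "(\<lambda>v. (cmod (if v \<in> V then f v else 0))\<^sup>2) summable_on V"
      using f[unfolded square_integrable_count_space] by (rule summable_on_cong[THEN iffD1, rotated]) simp
    then show "(\<lambda>v. if v \<in> V then f v else 0) \<in> carrier (ell2 V)"
      by (auto simp: ell2_def)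
  qed (simp add: AE_count_space)
next
  show "\<zero>\<^bsub>ell2 V\<^esub> \<in> carrier (ell2 V)" by (simp add: ell2_def)
  show "AE v in count_space V. \<zero>\<^bsub>ell2 V\<^esub> v = 0" by (simp add: ell2_def)
qed

text \<open>A class of functions modulo null sets is represented by one chosen code. The conjunct on
  integrability matters: a function that agrees almost everywhere with a measurable one need not
  be measurable, because \<open>M\<close> may be incomplete.\<close>

definition L2_element :: "'x measure \<Rightarrow> ('e \<Rightarrow> 'x \<Rightarrow> complex) \<Rightarrow> ('x \<Rightarrow> complex) \<Rightarrow> 'e" where
  "L2_element M dec f = (SOME x. square_integrable M (dec x) \<and> (AE \<omega> in M. dec x \<omega> = f \<omega>))"

definition L2_space :: "'x measure \<Rightarrow> ('e \<Rightarrow> 'x \<Rightarrow> complex) \<Rightarrow> 'e chilbert" where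
  "L2_space M dec =
     \<lparr>carrier = {L2_element M dec f | f. square_integrable M f},
      mult = undefined, one = undefined,
      zero = L2_element M dec (\<lambda>_. 0),
      add = (\<lambda>x y. L2_element M dec (\<lambda>\<omega>. dec x \<omega> + dec y \<omega>)),
      smult = (\<lambda>c x. L2_element M dec (\<lambda>\<omega>. c * dec x \<omega>)),
      ip = (\<lambda>x y. \<integral>\<omega>. dec x \<omega> * cnj (dec y \<omega>) \<partial>M)\<rparr>"

lemma L2_model_L2_space:
  fixes M :: "'x measure" and dec :: "'e \<Rightarrow> 'x \<Rightarrow> complex"
  assumes surj: "surj dec"
  shows "L2_model M (L2_space M dec) dec"
proof -
  have elem: "square_integrable M (dec (L2_element M dec f)) \<and> (AE \<omega> in M. dec (L2_element M dec f) \<omega> = f \<omega>)"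
    if "square_integrable M f" for f
  proof -
    obtain x where "f = dec x" using surj by (rule surjE)
    then have "square_integrable M (dec x) \<and> (AE \<omega> in M. dec x \<omega> = f \<omega>)" using that by simp
    then show ?thesis unfolding L2_element_def by (rule someI)
  qed
  have cong: "L2_element M dec f = L2_element M dec g" if eq: "AE \<omega> in M. f \<omega> = g \<omega>" for f g
  proof -
    have "(AE \<omega> in M. dec x \<omega> = f \<omega>) \<longleftrightarrow> (AE \<omega> in M. dec x \<omega> = g \<omega>)" for x
    proof
      assume "AE \<omega> in M. dec x \<omega> = f \<omega>"
      then show "AE \<omega> in M. dec x \<omega> = g \<omega>" using eq by eventually_elim simp
    next
      assume "AE \<omega> in M. dec x \<omega> = g \<omega>"
      then show "AE \<omega> in M. dec x \<omega> = f \<omega>" using eq by eventually_elim simp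
    qed
    then show ?thesis by (simp add: L2_element_def)
  qed
  have carrier: "x \<in> carrier (L2_space M dec) \<longleftrightarrow> (\<exists>f. square_integrable M f \<and> x = L2_element M dec f)" for x
    by (auto simp: L2_space_def)
  have in_carrier: "L2_element M dec f \<in> carrier (L2_space M dec)" if "square_integrable M f" for f
    using that unfolding carrier by blast
  have sq: "square_integrable M (dec x)" if "x \<in> carrier (L2_space M dec)" for x
    using that elem by (auto simp: carrier)
  show ?thesis
  proof
    fix x y :: 'e and c :: complex
    assume x: "x \<in> carrier (L2_space M dec)"
    show "square_integrable M (dec x)" using x by (rule sq)
    show "c \<odot>\<^bsub>L2_space M dec\<^esub> x \<in> carrier (L2_space M dec)"
      using in_carrier[OF square_integrable_scale[OF sq[OF x], of c]] by (simp add: L2_space_def)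
    show "AE \<omega> in M. dec (c \<odot>\<^bsub>L2_space M dec\<^esub> x) \<omega> = c * dec x \<omega>"
      using elem[OF square_integrable_scale[OF sq[OF x], of c]] by (simp add: L2_space_def)
    assume y: "y \<in> carrier (L2_space M dec)"
    show "x \<oplus>\<^bsub>L2_space M dec\<^esub> y \<in> carrier (L2_space M dec)"
      using in_carrier[OF square_integrable_add[OF sq[OF x] sq[OF y]]] by (simp add: L2_space_def)
    show "AE \<omega> in M. dec (x \<oplus>\<^bsub>L2_space M dec\<^esub> y) \<omega> = dec x \<omega> + dec y \<omega>"
      using elem[OF square_integrable_add[OF sq[OF x] sq[OF y]]] by (simp add: L2_space_def)
    show "ip (L2_space M dec) x y = (\<integral>\<omega>. dec x \<omega> * cnj (dec y \<omega>) \<partial>M)"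
      by (simp add: L2_space_def)
    assume eq: "AE \<omega> in M. dec x \<omega> = dec y \<omega>"
    obtain f g where f: "square_integrable M f" "x = L2_element M dec f"
      and g: "square_integrable M g" "y = L2_element M dec g"
      using x y unfolding carrier by blast
    have "AE \<omega> in M. f \<omega> = g \<omega>"
      using conjunct2[OF elem[OF f(1)]] conjunct2[OF elem[OF g(1)]] eq unfolding f(2) g(2)
      by eventually_elim simp
    then show "x = y" unfolding f(2) g(2) by (rule cong)
  next
    fix f assume "square_integrable M f"
    then show "\<exists>x\<in>carrier (L2_space M dec). AE \<omega> in M. dec x \<omega> = f \<omega>"
      using elem in_carrier by (intro bexI[of _ "L2_element M dec f"]) simp_all
  next
    show "\<zero>\<^bsub>L2_space M dec\<^esub> \<in> carrier (L2_space M dec)"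
      using in_carrier[of "\<lambda>_. 0"] by (simp add: L2_space_def)
    show "AE \<omega> in M. dec \<zero>\<^bsub>L2_space M dec\<^esub> \<omega> = 0"
      using elem[of "\<lambda>_. 0"] by (simp add: L2_space_def)
  qed
qed

text \<open>A function is coded by its graph, and a point of the graph (two integers, a real and a complex
  number) by a function on the vertices with these four values at four chosen vertices.\<close>

lemma surj_decoding: "\<exists>dec :: (vertex \<Rightarrow> complex) set \<Rightarrow> ((nat \<times> int) \<times> real \<Rightarrow> complex). surj dec"
proof -
  define code :: "((nat \<times> int) \<times> real) \<times> complex \<Rightarrow> vertex \<Rightarrow> complex" where
    "code = (\<lambda>(((i, n), s), z) v. if v = Trunk 0 then of_nat i else if v = Trunk 1 then of_int n
       else if v = Trunk 2 then of_real s else if v = Trunk 3 then z else 0)"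
  have code: "inj code"
  proof (rule injI)
    fix p q :: "((nat \<times> int) \<times> real) \<times> complex"
    assume eq: "code p = code q"
    show "p = q"
      using fun_cong[OF eq, of "Trunk 0"] fun_cong[OF eq, of "Trunk 1"]
        fun_cong[OF eq, of "Trunk 2"] fun_cong[OF eq, of "Trunk 3"]
      by (simp add: code_def split: prod.splits)
  qed
  define dec where "dec Y = (\<lambda>\<omega>. SOME z. code (\<omega>, z) \<in> Y)" for Y
  have "dec (range (\<lambda>\<omega>. code (\<omega>, f \<omega>))) = f" for f
  proof
    fix \<omega>
    have "code (\<omega>, z) \<in> range (\<lambda>\<omega>. code (\<omega>, f \<omega>)) \<longleftrightarrow> z = f \<omega>" for z
      using injD[OF code, of "(\<omega>, z)"] by auto
    then show "dec (range (\<lambda>\<omega>. code (\<omega>, f \<omega>))) \<omega> = f \<omega>" by (simp add: dec_def)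
  qed
  then have "surj dec" by (rule surjI[where f = "\<lambda>f. range (\<lambda>\<omega>. code (\<omega>, f \<omega>))"])
  then show ?thesis by (intro exI[of _ dec])
qed

text \<open>By polarization, a linear map preserving norms preserves inner products.\<close>

lemma hilbert_isometryI:
  assumes H: "L2_model M H d" and K: "L2_model M' K d'"
    and U: "U \<in> carrier H \<rightarrow> carrier K"
    and add: "\<And>x y. x \<in> carrier H \<Longrightarrow> y \<in> carrier H \<Longrightarrow> U (x \<oplus>\<^bsub>H\<^esub> y) = U x \<oplus>\<^bsub>K\<^esub> U y"
    and scale: "\<And>c x. x \<in> carrier H \<Longrightarrow> U (c \<odot>\<^bsub>H\<^esub> x) = c \<odot>\<^bsub>K\<^esub> U x"
    and norm: "\<And>x. x \<in> carrier H \<Longrightarrow> L2_norm M' (d' (U x)) = L2_norm M (d x)"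
  shows "hilbert_isometry H K U"
proof -
  interpret H: L2_model M H d by fact
  interpret K: L2_model M' K d' by fact
  interpret HH: complex_hilbert_space H by (rule H.complex_hilbert_space)
  interpret KK: complex_hilbert_space K by (rule K.complex_hilbert_space)
  have self: "ip K (U x) (U x) = ip H x x" if "x \<in> carrier H" for x
    using that U norm[OF that] H.ip_self[OF that] K.ip_self[of "U x"] by auto
  have re: "Re (ip K (U x) (U y)) = Re (ip H x y)" if xy: "x \<in> carrier H" "y \<in> carrier H" for x y
  proof -
    have Uxy: "U x \<in> carrier K" "U y \<in> carrier K" using U xy by auto
    have h: "Re (ip H (x \<oplus>\<^bsub>H\<^esub> y) (x \<oplus>\<^bsub>H\<^esub> y)) = Re (ip H x x) + Re (ip H y y) + 2 * Re (ip H x y)"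
    proof -
      have "ip H x (x \<oplus>\<^bsub>H\<^esub> y) = cnj (ip H (x \<oplus>\<^bsub>H\<^esub> y) x)" "ip H y (x \<oplus>\<^bsub>H\<^esub> y) = cnj (ip H (x \<oplus>\<^bsub>H\<^esub> y) y)"
        "ip H y x = cnj (ip H x y)"
        by (intro HH.ip_commute xy H.add_closed')+
      then show ?thesis using xy by (simp add: HH.ip_add_left H.add_closed')
    qed
    have k: "Re (ip K (U x \<oplus>\<^bsub>K\<^esub> U y) (U x \<oplus>\<^bsub>K\<^esub> U y)) = Re (ip K (U x) (U x)) + Re (ip K (U y) (U y)) + 2 * Re (ip K (U x) (U y))"
    proof -
      have "ip K (U x) (U x \<oplus>\<^bsub>K\<^esub> U y) = cnj (ip K (U x \<oplus>\<^bsub>K\<^esub> U y) (U x))"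
        "ip K (U y) (U x \<oplus>\<^bsub>K\<^esub> U y) = cnj (ip K (U x \<oplus>\<^bsub>K\<^esub> U y) (U y))"
        "ip K (U y) (U x) = cnj (ip K (U x) (U y))"
        by (intro KK.ip_commute Uxy K.add_closed')+
      then show ?thesis using Uxy by (simp add: KK.ip_add_left K.add_closed')
    qed
    show ?thesis
      using h k self[OF xy(1)] self[OF xy(2)] self[OF H.add_closed'[OF xy]] add[OF xy] by simp
  qed
  have "ip K (U x) (U y) = ip H x y" if xy: "x \<in> carrier H" "y \<in> carrier H" for x y
  proof (rule complex_eqI)
    have Uxy: "U x \<in> carrier K" "U y \<in> carrier K" using U xy by auto
    show "Re (ip K (U x) (U y)) = Re (ip H x y)" by (rule re[OF xy])
    show "Im (ip K (U x) (U y)) = Im (ip H x y)"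
      using re[OF H.scale_closed[OF xy(1), of "-\<i>"] xy(2)] scale[OF xy(1), of "-\<i>"]
        HH.ip_scale_left[OF xy, of "-\<i>"] KK.ip_scale_left[OF Uxy, of "-\<i>"] by simp
  qed
  then show ?thesis unfolding hilbert_isometry_def using U add scale by blast
qed

section \<open>Layers of measures indexed by branches and levels\<close>

lemma infsum_ennreal_nat:
  fixes f :: "nat \<Rightarrow> ennreal"
  shows "(\<Sum>\<^sub>\<infinity>i\<in>A. f i) = (\<integral>\<^sup>+ i. f i \<partial>count_space A)"
proof -
  have "(\<Sum>\<^sub>\<infinity>i\<in>A. f i) = (\<Sum>\<^sub>\<infinity>i. f i * indicator A i)"
    by (rule infsum_cong_neutral) (auto simp: indicator_def)
  also have "\<dots> = (\<Sum>i. f i * indicator A i)"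
  proof (rule sums_unique)
    have "((\<lambda>i. f i * indicator A i) has_sum (\<Sum>\<^sub>\<infinity>i. f i * indicator A i)) UNIV"
      by (intro has_sum_infsum nonneg_summable_on_complete) simp
    then show "(\<lambda>i. f i * indicator A i) sums (\<Sum>\<^sub>\<infinity>i. f i * indicator A i)"
      by (rule has_sum_imp_sums)
  qed
  also have "\<dots> = (\<integral>\<^sup>+ i. f i \<partial>count_space A)"
    by (simp add: nn_integral_count_space_nat[symmetric] nn_integral_count_space_indicator)
  finally show ?thesis .
qed

text \<open>A point \<open>((i, n), s)\<close> consists of a branch, a level and a spectral value. The measure on it
  has the same fibre \<open>R i\<close> at every level \<open>n\<close>, which makes it invariant under changing the level. The
  monadic bind over a counting measure is a convenient form of the sum of all these fibres: it only
  asks that each fibre has mass at most \<open>1\<close>.\<close>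

definition fibre_space :: "((nat \<times> int) \<times> real) measure" where
  "fibre_space = count_space UNIV \<Otimes>\<^sub>M borel"

definition layered_measure :: "(nat \<Rightarrow> real measure) \<Rightarrow> ((nat \<times> int) \<times> real) measure" where
  "layered_measure R = count_space UNIV \<bind> (\<lambda>p. distr (R (fst p)) fibre_space (Pair p))"

definition level_shift :: "int \<Rightarrow> (nat \<times> int) \<times> real \<Rightarrow> (nat \<times> int) \<times> real" where
  "level_shift k \<omega> = ((fst (fst \<omega>), snd (fst \<omega>) + k), snd \<omega>)"

lemma space_fibre_space [simp]: "space fibre_space = UNIV"
  by (simp add: fibre_space_def space_pair_measure)

lemma level_shift_measurable [measurable]: "level_shift k \<in> measurable fibre_space fibre_space"
  unfolding level_shift_def fibre_space_def by measurable

lemma measurable_fibre_spaceI: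
  assumes "\<And>p. (\<lambda>s. f (p, s)) \<in> measurable borel N"
  shows "f \<in> measurable fibre_space N"
  unfolding fibre_space_def
  by (rule measurable_pair_measure_countable1) (use assms in auto)

text \<open>The fibres may live on subspaces of the real line such as the half-line, hence the
  condition on the identity instead of an equality of \<open>\<sigma>\<close>-algebras.\<close>

locale layers =
  fixes R :: "nat \<Rightarrow> real measure"
  assumes R_id: "(\<lambda>s. s) \<in> measurable (R i) borel" and R_subprob: "subprob_space (R i)"
begin

abbreviation "M \<equiv> layered_measure R"

lemma Pair_measurable: "Pair p \<in> measurable (R i) fibre_space"
  unfolding fibre_space_def
  using measurable_Pair[OF measurable_const[of p "count_space UNIV" "R i"] R_id[of i]] by simp

lemma kernel_measurable:
  "(\<lambda>p. distr (R (fst p)) fibre_space (Pair p)) \<in> measurable (count_space UNIV) (subprob_algebra fibre_space)"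
  by (auto simp: space_subprob_algebra intro!: subprob_space.subprob_space_distr R_subprob Pair_measurable)

lemma sets_M [simp, measurable_cong]: "sets M = sets fibre_space"
  unfolding layered_measure_def by (rule sets_bind) auto

lemma space_M [simp]: "space M = UNIV"
  using sets_eq_imp_space_eq[OF sets_M] by simp

lemma nn_integral_M:
  assumes [measurable]: "f \<in> borel_measurable fibre_space"
  shows "(\<integral>\<^sup>+ \<omega>. f \<omega> \<partial>M) = (\<integral>\<^sup>+ p. (\<integral>\<^sup>+ s. f (p, s) \<partial>R (fst p)) \<partial>count_space UNIV)"
  unfolding layered_measure_def nn_integral_bind[OF assms kernel_measurable]
  by (intro nn_integral_cong nn_integral_distr Pair_measurable) simp

lemma AE_M:
  assumes P: "Measurable.pred fibre_space P" and AE: "\<And>p. AE s in R (fst p). P (p, s)"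
  shows "AE \<omega> in M. P \<omega>"
  unfolding layered_measure_def AE_bind[OF kernel_measurable P]
proof (rule AE_I2)
  fix p :: "nat \<times> int"
  note [measurable] = P
  have "{\<omega> \<in> space fibre_space. P \<omega>} \<in> sets fibre_space" by measurable
  then show "AE \<omega> in distr (R (fst p)) fibre_space (Pair p). P \<omega>"
    using AE by (subst AE_distr_iff) (auto intro: Pair_measurable)
qed

lemma distr_level_shift: "distr M M (level_shift k) = M"
proof (rule measure_eqI)
  fix A assume "A \<in> sets (distr M M (level_shift k))"
  then have [measurable]: "A \<in> sets fibre_space" by simp
  have "emeasure (distr M M (level_shift k)) A = (\<integral>\<^sup>+ \<omega>. indicator A \<omega> \<partial>distr M M (level_shift k))"
    by simp
  also have "\<dots> = (\<integral>\<^sup>+ \<omega>. indicator A (level_shift k \<omega>) \<partial>M)"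
    by (rule nn_integral_distr) measurable
  also have "\<dots> = (\<integral>\<^sup>+ p. (\<integral>\<^sup>+ s. indicator A (level_shift k (p, s)) \<partial>R (fst p)) \<partial>count_space UNIV)"
    by (rule nn_integral_M) measurable
  also have "\<dots> = (\<integral>\<^sup>+ p. (\<integral>\<^sup>+ s. indicator A ((fst p, snd p + k), s) \<partial>R (fst p)) \<partial>count_space UNIV)"
    by (simp add: level_shift_def)
  also have "\<dots> = (\<integral>\<^sup>+ p. (\<lambda>q. \<integral>\<^sup>+ s. indicator A (q, s) \<partial>R (fst q)) ((\<lambda>p. (fst p, snd p + k)) p) \<partial>count_space UNIV)"
    by simp
  also have "\<dots> = (\<integral>\<^sup>+ q. (\<integral>\<^sup>+ s. indicator A (q, s) \<partial>R (fst q)) \<partial>count_space UNIV)"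
  proof (rule nn_integral_bij_count_space)
    show "bij (\<lambda>p :: nat \<times> int. (fst p, snd p + k))"
      by (rule bij_betw_byWitness[where f' = "\<lambda>p. (fst p, snd p - k)"]) auto
  qed
  also have "\<dots> = (\<integral>\<^sup>+ \<omega>. indicator A \<omega> \<partial>M)"
    by (rule nn_integral_M[symmetric]) measurable
  also have "\<dots> = emeasure M A" by simp
  finally show "emeasure (distr M M (level_shift k)) A = emeasure M A" .
qed simp

text \<open>This is the operator \<open>(N F)(i, n, s) = \<surd>s F(i, n - 1, s)\<close>.\<close>

lemma weighted_composition_level_shift:
  assumes "surj dec"
  shows "weighted_composition M (L2_space M dec) dec (level_shift (-1)) (level_shift 1) (\<lambda>\<omega>. sqrt (snd \<omega>))"
proof -
  interpret L2_model M "L2_space M dec" dec by (rule L2_model_L2_space[OF assms])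
  show ?thesis
  proof
    show "distr M M (level_shift (-1)) = M" by (rule distr_level_shift)
    show "(\<lambda>\<omega>. sqrt (snd \<omega>)) \<in> borel_measurable M"
      by (rule measurable_fibre_spaceI[THEN measurable_cong_sets[OF sets_M refl, THEN equalityD2, THEN subsetD]]) simp
  qed (auto simp: level_shift_def)
qed

end

section \<open>The tree and its moment conditions\<close>

text \<open>The squared norm that the trunk vertex \<open>-k\<close> receives from the branches. The conditions (i), (ii),
  (iv) say that it is \<open>1\<close>, or at most \<open>1\<close> if \<open>-k\<close> is the root.\<close>

definition trunk_mass :: "enat \<Rightarrow> (vertex \<Rightarrow> complex) \<Rightarrow> (nat \<Rightarrow> real measure) \<Rightarrow> nat \<Rightarrow> ennreal" where
  "trunk_mass \<eta> wt \<mu> k = ennreal ((cmod (\<Prod>j<k. wt (Trunk j)))\<^sup>2) *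
     (\<Sum>\<^sub>\<infinity>i\<in>J \<eta>. ennreal ((cmod (wt (Branch i 1)))\<^sup>2) * (\<integral>\<^sup>+ s. 1 / ennreal s ^ (k + 1) \<partial>\<mu> i))"

lemma zero_notin_J [simp]: "0 \<notin> J \<iota>"
  by (simp add: J_def)

lemma Trunk_in_tree_V: "Trunk k \<in> tree_V \<eta> \<kappa> \<longleftrightarrow> enat k \<le> \<kappa>"
  by (cases k) (auto simp: tree_V_def J_def zero_enat_def[symmetric])

lemma Branch_in_tree_V: "Branch i j \<in> tree_V \<eta> \<kappa> \<longleftrightarrow> i \<in> J \<eta> \<and> 1 \<le> j"
  by (auto simp: tree_V_def)

lemma Trunk_in_tree_V0: "Trunk k \<in> tree_V0 \<eta> \<kappa> \<longleftrightarrow> enat k < \<kappa>"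
  by (auto simp: tree_V0_def Trunk_in_tree_V order_less_le)

lemma Branch_in_tree_V0: "Branch i j \<in> tree_V0 \<eta> \<kappa> \<longleftrightarrow> i \<in> J \<eta> \<and> 1 \<le> j"
  by (auto simp: tree_V0_def Branch_in_tree_V)

lemma parent_Trunk: "enat k < \<kappa> \<Longrightarrow> parent \<eta> \<kappa> (Trunk k) = Trunk (Suc k)"
  unfolding parent_def tree_E_def J_def
  by (rule the_equality) (auto simp: Suc_ile_eq)

lemma parent_Branch_1: "i \<in> J \<eta> \<Longrightarrow> parent \<eta> \<kappa> (Branch i 1) = Trunk 0"
  unfolding parent_def tree_E_def by (rule the_equality) auto

lemma parent_Branch_Suc: "i \<in> J \<eta> \<Longrightarrow> 1 \<le> j \<Longrightarrow> parent \<eta> \<kappa> (Branch i (Suc j)) = Branch i j"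
  unfolding parent_def tree_E_def by (rule the_equality) auto

lemma countable_vertices: "countable (W :: vertex set)"
proof (rule countable_subset)
  show "W \<subseteq> range Trunk \<union> range (case_prod Branch)"
  proof
    fix v assume "v \<in> W"
    show "v \<in> range Trunk \<union> range (case_prod Branch)" by (cases v) (auto intro: rev_image_eqI)
  qed
qed auto

text \<open>The common form of the four sets of conditions.\<close>

locale moment_tree =
  fixes \<eta> \<kappa> :: enat and wt :: "vertex \<Rightarrow> complex" and \<mu> :: "nat \<Rightarrow> real measure"
  assumes wt_nonzero: "v \<in> tree_V0 \<eta> \<kappa> \<Longrightarrow> wt v \<noteq> 0"
    and e0_in_Domain: "indicator {Trunk 0} \<in> Domain (weighted_shift \<eta> \<kappa> wt)"
    and prob: "i \<in> J \<eta> \<Longrightarrow> borel_prob_Rplus (\<mu> i)"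
    and moments: "1 \<le> n \<Longrightarrow> i \<in> J \<eta> \<Longrightarrow>
           (\<integral>\<^sup>+ s. ennreal s ^ n \<partial>\<mu> i) = ennreal ((cmod (\<Prod>j=2..n+1. wt (Branch i j)))\<^sup>2)"
    and trunk_mass_eq: "enat k < \<kappa> \<Longrightarrow> trunk_mass \<eta> wt \<mu> k = 1"
    and trunk_mass_le: "\<kappa> = enat k \<Longrightarrow> trunk_mass \<eta> wt \<mu> k \<le> 1"
begin

definition child_weight :: "nat \<Rightarrow> real" where "child_weight i = (cmod (wt (Branch i 1)))\<^sup>2"

lemma child_weight_pos: "i \<in> J \<eta> \<Longrightarrow> 0 < child_weight i"
  using wt_nonzero[of "Branch i 1"] by (simp add: child_weight_def Branch_in_tree_V0)

lemma sets_mu: "i \<in> J \<eta> \<Longrightarrow> sets (\<mu> i) = sets borel_Rplus"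
  using prob by (simp add: borel_prob_Rplus_def)

lemma mu_id [measurable]: "i \<in> J \<eta> \<Longrightarrow> (\<lambda>s. s) \<in> measurable (\<mu> i) borel"
  unfolding measurable_cong_sets[OF sets_mu refl] by (rule measurable_restrict_space1) simp

lemma space_mu: "i \<in> J \<eta> \<Longrightarrow> space (\<mu> i) = {0..}"
  using sets_eq_imp_space_eq[OF sets_mu] by (simp add: space_restrict_space)

lemma fibre_mass_le_1:
  assumes i: "i \<in> J \<eta>"
  shows "ennreal (child_weight i) * (\<integral>\<^sup>+ s. 1 / ennreal s \<partial>\<mu> i) \<le> 1"
proof -
  have "ennreal (child_weight i) * (\<integral>\<^sup>+ s. 1 / ennreal s \<partial>\<mu> i)
      \<le> (\<integral>\<^sup>+ i. ennreal (child_weight i) * (\<integral>\<^sup>+ s. 1 / ennreal s \<partial>\<mu> i) \<partial>count_space (J \<eta>))"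
    using i by (rule nn_integral_ge_point)
  also have "\<dots> = trunk_mass \<eta> wt \<mu> 0"
    by (simp add: trunk_mass_def infsum_ennreal_nat child_weight_def)
  also have "\<dots> \<le> 1"
    using trunk_mass_eq[of 0] trunk_mass_le[of 0]
    by (cases "\<kappa> = 0") (auto simp: zero_enat_def[symmetric])
  finally show ?thesis .
qed

text \<open>A point mass of \<open>\<mu> i\<close> at \<open>0\<close> would make the integral of \<open>1/s\<close> infinite.\<close>

lemma AE_pos:
  assumes i: "i \<in> J \<eta>"
  shows "AE s in \<mu> i. 0 < s"
proof -
  note [measurable] = mu_id[OF i]
  have "(\<integral>\<^sup>+ s. 1 / ennreal s \<partial>\<mu> i) \<noteq> \<infinity>"
    using fibre_mass_le_1[OF i] child_weight_pos[OF i] by (auto simp: ennreal_mult_top top_unique)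
  then have "AE s in \<mu> i. 1 / ennreal s \<noteq> \<infinity>"
    by (rule nn_integral_PInf_AE[rotated]) measurable
  then show ?thesis
    using AE_space
  proof eventually_elim
    case (elim s)
    then have "0 \<le> s" using space_mu[OF i] by simp
    with elim(1) show ?case by (cases "s = 0") auto
  qed
qed

text \<open>For a branch \<open>i\<close> this is \<open>|\<lambda>\<^sub>i\<^sub>,\<^sub>1|\<^sup>2 s\<^sup>-\<^sup>1 d\<mu>\<^sub>i\<close>. The index \<open>0\<close>, which is no branch,
  holds the additional layer at the spectral value \<open>0\<close> for the deficiency at the root.\<close>

definition R :: "nat \<Rightarrow> real measure" where
  "R i = (if i \<in> J \<eta> then density (\<mu> i) (\<lambda>s. ennreal (child_weight i) * (1 / ennreal s))
          else if i = 0 then return borel 0 else null_measure borel)"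

lemma R_id: "(\<lambda>s. s) \<in> measurable (R i) borel"
    by (cases "i \<in> J \<eta>")
      (simp_all add: R_def mu_id measurable_def[of "null_measure borel"])

lemma R_subprob: "subprob_space (R i)"
proof (cases "i \<in> J \<eta>")
  case True
  note [measurable] = mu_id[OF True]
  have "emeasure (R i) (space (R i)) = (\<integral>\<^sup>+ s. ennreal (child_weight i) * (1 / ennreal s) \<partial>\<mu> i)"
    using True by (simp add: R_def emeasure_density cong: nn_integral_cong)
  also have "\<dots> = ennreal (child_weight i) * (\<integral>\<^sup>+ s. 1 / ennreal s \<partial>\<mu> i)"
    by (rule nn_integral_cmult) measurable
  finally have "emeasure (R i) (space (R i)) \<le> 1" using fibre_mass_le_1[OF True] by simp
  moreover have "space (R i) \<noteq> {}" using True space_mu[OF True] by (auto simp: R_def)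
  ultimately show ?thesis by (intro subprob_spaceI)
next
  case False
  then show ?thesis
    by (auto simp: R_def intro!: subprob_spaceI)
qed

sublocale layers R
  by (intro layers.intro R_id R_subprob)

section \<open>The isometric embedding\<close>

text \<open>All pairs \<open>(i, -k)\<close> with \<open>k \<ge> 0\<close> stand for the one trunk vertex \<open>-k\<close>, which is spread over all
  layers of its level. Pairs for which the value is not a vertex of the tree
  are harmless, because elements of \<open>\<ell>\<^sup>2\<close> of the tree vanish there.\<close>

definition vertex_at :: "nat \<times> int \<Rightarrow> vertex" where
  "vertex_at p = (if snd p \<le> 0 then Trunk (nat (- snd p)) else Branch (fst p) (nat (snd p)))"

definition profile :: "nat \<Rightarrow> int \<Rightarrow> real \<Rightarrow> real" where
  "profile i n s = (if i = 0 then 1 else s powr (real_of_int n / 2))"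

text \<open>The factor of the basis vector at \<open>vertex_at p\<close> in layer \<open>p\<close>: for the branches the
  constants that make the shift act by \<open>\<surd>s\<close>, starting from \<open>1\<close> at the branching vertex,
  and for the layer \<open>0\<close> the square root of the deficiency at the root.\<close>

definition amplitude :: "nat \<times> int \<Rightarrow> complex" where
  "amplitude p =
     (if fst p = 0 then
        (if enat (nat (- snd p)) = \<kappa> then of_real (sqrt (enn2real (1 - trunk_mass \<eta> wt \<mu> (nat (- snd p))))) else 0)
      else if snd p \<le> 0 then \<Prod>j<nat (- snd p). wt (Trunk j)
      else 1 / (\<Prod>m=1..nat (snd p). wt (Branch (fst p) m)))"

definition embed :: "(vertex \<Rightarrow> complex) \<Rightarrow> (nat \<times> int) \<times> real \<Rightarrow> complex" where
  "embed f \<omega> = f (vertex_at (fst \<omega>)) * amplitude (fst \<omega>) * of_real (profile (fst (fst \<omega>)) (snd (fst \<omega>)) (snd \<omega>))"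

lemma profile_power2: "(profile i n s)\<^sup>2 = (if i = 0 then 1 else s powr real_of_int n)"
  by (simp add: profile_def power2_eq_square powr_add[symmetric])

lemma mass_defect: "(\<integral>\<^sup>+ s. ennreal ((profile 0 n s)\<^sup>2) \<partial>R 0) = 1"
  by (simp add: R_def profile_def nn_integral_return)

lemma mass_off: "i \<notin> J \<eta> \<Longrightarrow> i \<noteq> 0 \<Longrightarrow> (\<integral>\<^sup>+ s. f s \<partial>R i) = 0"
  by (simp add: R_def)

text \<open>Up to null sets the arithmetic with \<open>1/s\<close> takes place among finite positive numbers.\<close>

lemma mass_R:
  assumes i: "i \<in> J \<eta>"
  shows "(\<integral>\<^sup>+ s. ennreal ((profile i n s)\<^sup>2) \<partial>R i)
    = (\<integral>\<^sup>+ s. ennreal (child_weight i * (1 / s) * s powr real_of_int n) \<partial>\<mu> i)"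
proof -
  note [measurable] = mu_id[OF i]
  have i0: "i \<noteq> 0" using i by (metis zero_notin_J)
  have "(\<integral>\<^sup>+ s. ennreal ((profile i n s)\<^sup>2) \<partial>R i)
      = (\<integral>\<^sup>+ s. ennreal (child_weight i) * (1 / ennreal s) * ennreal (s powr real_of_int n) \<partial>\<mu> i)"
    using i i0 by (simp add: R_def nn_integral_density profile_power2)
  also have "\<dots> = (\<integral>\<^sup>+ s. ennreal (child_weight i * (1 / s) * s powr real_of_int n) \<partial>\<mu> i)"
  proof (rule nn_integral_cong_AE)
    show "AE s in \<mu> i. ennreal (child_weight i) * (1 / ennreal s) * ennreal (s powr real_of_int n)
        = ennreal (child_weight i * (1 / s) * s powr real_of_int n)"
      using AE_pos[OF i]
    proof eventually_elim
      case (elim s)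
      then have "1 / ennreal s = ennreal (1 / s)"
        using divide_ennreal[of 1 s] by simp
      then show ?case using elim child_weight_pos[OF i] by (simp add: ennreal_mult[symmetric])
    qed
  qed
  finally show ?thesis .
qed

lemma mass_trunk:
  assumes i: "i \<in> J \<eta>"
  shows "(\<integral>\<^sup>+ s. ennreal ((profile i (- int k) s)\<^sup>2) \<partial>R i)
    = ennreal (child_weight i) * (\<integral>\<^sup>+ s. 1 / ennreal s ^ (k + 1) \<partial>\<mu> i)"
proof -
  note [measurable] = mu_id[OF i]
  have "(\<integral>\<^sup>+ s. ennreal (child_weight i * (1 / s) * s powr real_of_int (- int k)) \<partial>\<mu> i)
      = (\<integral>\<^sup>+ s. ennreal (child_weight i) * (1 / ennreal s ^ (k + 1)) \<partial>\<mu> i)"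
  proof (rule nn_integral_cong_AE)
    show "AE s in \<mu> i. ennreal (child_weight i * (1 / s) * s powr real_of_int (- int k)) = ennreal (child_weight i) * (1 / ennreal s ^ (k + 1))"
      using AE_pos[OF i]
    proof eventually_elim
      case (elim s)
      have "1 / ennreal s ^ (k + 1) = ennreal (1 / s ^ (k + 1))"
        using elim divide_ennreal[of 1 "s ^ (k + 1)"] by (simp add: ennreal_power del: power_Suc)
      moreover have "child_weight i * (1 / s) * s powr real_of_int (- int k) = child_weight i * (1 / s ^ (k + 1))"
        using elim by (simp add: powr_minus powr_realpow field_simps)
      ultimately show ?case using child_weight_pos[OF i] elim by (simp add: ennreal_mult[symmetric] del: power_Suc)
    qed
  qed
  also have "\<dots> = ennreal (child_weight i) * (\<integral>\<^sup>+ s. 1 / ennreal s ^ (k + 1) \<partial>\<mu> i)"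
    by (rule nn_integral_cmult) measurable
  finally show ?thesis by (simp add: mass_R[OF i])
qed

lemma mass_branch:
  assumes i: "i \<in> J \<eta>" and j: "1 \<le> j"
  shows "(\<integral>\<^sup>+ s. ennreal ((profile i (int j) s)\<^sup>2) \<partial>R i) = ennreal ((cmod (\<Prod>m=1..j. wt (Branch i m)))\<^sup>2)"
proof -
  note [measurable] = mu_id[OF i]
  interpret prob_space "\<mu> i" using prob[OF i] by (simp add: borel_prob_Rplus_def)
  have "(\<integral>\<^sup>+ s. ennreal (child_weight i * (1 / s) * s powr real_of_int (int j)) \<partial>\<mu> i)
      = (\<integral>\<^sup>+ s. ennreal (child_weight i) * ennreal s ^ (j - 1) \<partial>\<mu> i)"
  proof (rule nn_integral_cong_AE)
    show "AE s in \<mu> i. ennreal (child_weight i * (1 / s) * s powr real_of_int (int j)) = ennreal (child_weight i) * ennreal s ^ (j - 1)"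
      using AE_pos[OF i]
    proof eventually_elim
      case (elim s)
      obtain m where m: "j = Suc m" using j by (cases j) auto
      have "child_weight i * (1 / s) * s powr real_of_int (int j) = child_weight i * s ^ m"
        using elim m by (simp add: powr_realpow del: of_nat_Suc)
      then show ?case using child_weight_pos[OF i] elim m by (simp add: ennreal_mult ennreal_power)
    qed
  qed
  also have "\<dots> = ennreal (child_weight i) * (\<integral>\<^sup>+ s. ennreal s ^ (j - 1) \<partial>\<mu> i)"
    by (rule nn_integral_cmult) measurable
  also have "(\<integral>\<^sup>+ s. ennreal s ^ (j - 1) \<partial>\<mu> i) = ennreal ((cmod (\<Prod>m=2..j. wt (Branch i m)))\<^sup>2)"
  proof (cases "j = 1")
    case True
    then show ?thesis by (simp add: emeasure_space_1)
  next
    case False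
    then show ?thesis using moments[of "j - 1" i] i j by simp
  qed
  also have "ennreal (child_weight i) * \<dots> = ennreal ((cmod (\<Prod>m=1..j. wt (Branch i m)))\<^sup>2)"
  proof -
    have "(\<Prod>m=1..j. wt (Branch i m)) = wt (Branch i 1) * (\<Prod>m=2..j. wt (Branch i m))"
      using j by (subst prod.atLeast_Suc_atMost) (auto simp: numeral_2_eq_2)
    then show ?thesis by (simp add: child_weight_def ennreal_mult norm_mult power_mult_distrib)
  qed
  finally show ?thesis by (simp add: mass_R[OF i])
qed

definition layer_mass :: "nat \<times> int \<Rightarrow> ennreal" where
  "layer_mass p = ennreal ((cmod (amplitude p))\<^sup>2) * (\<integral>\<^sup>+ s. ennreal ((profile (fst p) (snd p) s)\<^sup>2) \<partial>R (fst p))"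

lemma trunk_mass_le_1: "enat k \<le> \<kappa> \<Longrightarrow> trunk_mass \<eta> wt \<mu> k \<le> 1"
  using trunk_mass_eq[of k] trunk_mass_le[of k] by (cases "\<kappa> = enat k") auto

text \<open>Every basis vector is mapped to a unit vector. At a branch vertex only one layer
  contributes, and this is the moment condition of the branch. At a trunk vertex
  the branches contribute \<open>trunk_mass\<close>; the layer \<open>0\<close> completes this to \<open>1\<close> at the root.\<close>

lemma vertex_mass:
  assumes v: "v \<in> tree_V \<eta> \<kappa>"
  shows "(\<integral>\<^sup>+ p. layer_mass p * indicator {p. vertex_at p = v} p \<partial>count_space UNIV) = 1"
proof (cases v)
  case (Branch i j)
  then have i: "i \<in> J \<eta>" and j: "1 \<le> j" using v by (auto simp: Branch_in_tree_V)
  have i0: "i \<noteq> 0" using i by (metis zero_notin_J)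
  have "{p. vertex_at p = v} = {(i, int j)}"
    using j Branch by (auto simp: vertex_at_def)
  then have "(\<integral>\<^sup>+ p. layer_mass p * indicator {p. vertex_at p = v} p \<partial>count_space UNIV) = layer_mass (i, int j)"
    by (simp add: nn_integral_indicator_singleton)
  also have "\<dots> = 1"
  proof -
    have "(\<Prod>m=1..j. wt (Branch i m)) \<noteq> 0"
      using i by (auto simp: wt_nonzero Branch_in_tree_V0)
    then show ?thesis
      using i0 j by (simp add: layer_mass_def mass_branch[OF i j] amplitude_def norm_divide power_divide
          ennreal_mult[symmetric] del: prod_zero_iff)
  qed
  finally show ?thesis .
next
  case (Trunk k)
  then have k: "enat k \<le> \<kappa>" using v by (simp add: Trunk_in_tree_V)
  have bij: "bij_betw (\<lambda>i. (i, - int k)) UNIV {p. vertex_at p = v}"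
    using Trunk by (intro bij_betwI[where g = fst]) (auto simp: vertex_at_def split: if_splits)
  have "(\<integral>\<^sup>+ p. layer_mass p * indicator {p. vertex_at p = v} p \<partial>count_space UNIV) = (\<integral>\<^sup>+ p. layer_mass p \<partial>count_space {p. vertex_at p = v})"
    by (simp add: nn_integral_count_space_indicator)
  also have "\<dots> = (\<integral>\<^sup>+ i. layer_mass (i, - int k) \<partial>count_space UNIV)"
    by (rule nn_integral_bij_count_space[OF bij, symmetric])
  also have "\<dots> = (\<integral>\<^sup>+ i. layer_mass (i, - int k) * indicator (J \<eta>) i + layer_mass (0, - int k) * indicator {0} i \<partial>count_space UNIV)"
    by (rule nn_integral_cong) (auto simp: layer_mass_def mass_off indicator_def)
  also have "\<dots> = (\<integral>\<^sup>+ i. layer_mass (i, - int k) \<partial>count_space (J \<eta>)) + layer_mass (0, - int k)"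
    by (subst nn_integral_add) (simp_all add: nn_integral_count_space_indicator nn_integral_indicator_singleton)
  also have "(\<integral>\<^sup>+ i. layer_mass (i, - int k) \<partial>count_space (J \<eta>)) = trunk_mass \<eta> wt \<mu> k"
  proof -
    have "(\<integral>\<^sup>+ i. layer_mass (i, - int k) \<partial>count_space (J \<eta>))
        = (\<integral>\<^sup>+ i. ennreal ((cmod (\<Prod>j<k. wt (Trunk j)))\<^sup>2) * (ennreal (child_weight i) * (\<integral>\<^sup>+ s. 1 / ennreal s ^ (k + 1) \<partial>\<mu> i)) \<partial>count_space (J \<eta>))"
    proof (rule nn_integral_cong)
      fix i assume "i \<in> space (count_space (J \<eta>))"
      then have i: "i \<in> J \<eta>" by simp
      have i0: "i \<noteq> 0" using i by (metis zero_notin_J)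
      show "layer_mass (i, - int k) = ennreal ((cmod (\<Prod>j<k. wt (Trunk j)))\<^sup>2) * (ennreal (child_weight i) * (\<integral>\<^sup>+ s. 1 / ennreal s ^ (k + 1) \<partial>\<mu> i))"
        unfolding layer_mass_def fst_conv snd_conv mass_trunk[OF i] using i0 by (simp add: amplitude_def)
    qed
    then show ?thesis
      by (simp add: trunk_mass_def infsum_ennreal_nat child_weight_def nn_integral_cmult)
  qed
  also have "layer_mass (0, - int k) = 1 - trunk_mass \<eta> wt \<mu> k"
  proof (cases "enat k = \<kappa>")
    case True
    have "1 - trunk_mass \<eta> wt \<mu> k \<noteq> \<infinity>" by simp
    then show ?thesis
      unfolding layer_mass_def fst_conv snd_conv mass_defect
      by (simp add: amplitude_def True power2_eq_square[of "sqrt _"] enn2real_nonneg norm_mult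
          real_sqrt_pow2 less_top[symmetric])
  next
    case False
    then have "trunk_mass \<eta> wt \<mu> k = 1" using k trunk_mass_eq by simp
    then show ?thesis using False by (simp add: layer_mass_def amplitude_def)
  qed
  also have "trunk_mass \<eta> wt \<mu> k + (1 - trunk_mass \<eta> wt \<mu> k) = 1"
    by (rule add_diff_inverse_ennreal[OF trunk_mass_le_1[OF k]])
  finally show ?thesis .
qed

lemma embed_measurable [measurable]: "embed f \<in> borel_measurable fibre_space"
  by (rule measurable_fibre_spaceI) (simp add: embed_def profile_def)

text \<open>Different vertices occupy disjoint layers, so the norms of the basis vectors determine
  the norm of every element; the proof groups the layers by their vertex.\<close>

lemma nn_integral_embed:
  assumes f: "\<And>v. v \<notin> tree_V \<eta> \<kappa> \<Longrightarrow> f v = 0"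
  shows "(\<integral>\<^sup>+ \<omega>. ennreal ((cmod (embed f \<omega>))\<^sup>2) \<partial>M)
    = (\<integral>\<^sup>+ v. ennreal ((cmod (f v))\<^sup>2) \<partial>count_space (tree_V \<eta> \<kappa>))"
proof -
  let ?V = "tree_V \<eta> \<kappa>"
  have "(\<integral>\<^sup>+ \<omega>. ennreal ((cmod (embed f \<omega>))\<^sup>2) \<partial>M)
      = (\<integral>\<^sup>+ p. (\<integral>\<^sup>+ s. ennreal ((cmod (embed f (p, s)))\<^sup>2) \<partial>R (fst p)) \<partial>count_space UNIV)"
    by (rule nn_integral_M) measurable
  also have "\<dots> = (\<integral>\<^sup>+ p. ennreal ((cmod (f (vertex_at p)))\<^sup>2) * layer_mass p \<partial>count_space UNIV)"
  proof (rule nn_integral_cong)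
    fix p :: "nat \<times> int"
    note [measurable] = R_id[of "fst p"]
    have "(\<integral>\<^sup>+ s. ennreal ((cmod (embed f (p, s)))\<^sup>2) \<partial>R (fst p))
        = (\<integral>\<^sup>+ s. ennreal ((cmod (f (vertex_at p)))\<^sup>2 * (cmod (amplitude p))\<^sup>2) * ennreal ((profile (fst p) (snd p) s)\<^sup>2) \<partial>R (fst p))"
      by (rule nn_integral_cong) (simp add: embed_def norm_mult power_mult_distrib ennreal_mult)
    also have "\<dots> = ennreal ((cmod (f (vertex_at p)))\<^sup>2 * (cmod (amplitude p))\<^sup>2) * (\<integral>\<^sup>+ s. ennreal ((profile (fst p) (snd p) s)\<^sup>2) \<partial>R (fst p))"
      by (rule nn_integral_cmult) (simp add: profile_def)
    finally show "(\<integral>\<^sup>+ s. ennreal ((cmod (embed f (p, s)))\<^sup>2) \<partial>R (fst p)) = ennreal ((cmod (f (vertex_at p)))\<^sup>2) * layer_mass p"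
      by (simp add: layer_mass_def ennreal_mult mult.assoc)
  qed
  also have "\<dots> = (\<integral>\<^sup>+ p. (\<integral>\<^sup>+ v. ennreal ((cmod (f v))\<^sup>2) * (layer_mass p * indicator {p. vertex_at p = v} p) \<partial>count_space ?V) \<partial>count_space UNIV)"
  proof (rule nn_integral_cong)
    fix p :: "nat \<times> int"
    have "(\<integral>\<^sup>+ v. ennreal ((cmod (f v))\<^sup>2) * (layer_mass p * indicator {p. vertex_at p = v} p) \<partial>count_space ?V)
        = (\<integral>\<^sup>+ v. ennreal ((cmod (f v))\<^sup>2) * (layer_mass p * indicator {p. vertex_at p = v} p) * indicator ?V v \<partial>count_space UNIV)"
      by (simp add: nn_integral_count_space_indicator)
    also have "\<dots> = (\<integral>\<^sup>+ v. (ennreal ((cmod (f v))\<^sup>2) * layer_mass p) * indicator {vertex_at p} v \<partial>count_space UNIV)"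
      by (rule nn_integral_cong) (use f in \<open>auto simp: indicator_def\<close>)
    also have "\<dots> = ennreal ((cmod (f (vertex_at p)))\<^sup>2) * layer_mass p"
      by (simp add: nn_integral_indicator_singleton)
    finally show "ennreal ((cmod (f (vertex_at p)))\<^sup>2) * layer_mass p
        = (\<integral>\<^sup>+ v. ennreal ((cmod (f v))\<^sup>2) * (layer_mass p * indicator {p. vertex_at p = v} p) \<partial>count_space ?V)" ..
  qed
  also have "\<dots> = (\<integral>\<^sup>+ v. (\<integral>\<^sup>+ p. ennreal ((cmod (f v))\<^sup>2) * (layer_mass p * indicator {p. vertex_at p = v} p) \<partial>count_space UNIV) \<partial>count_space ?V)"
    by (rule nn_integral_count_space_nn_integral[OF countable_vertices]) simp
  also have "\<dots> = (\<integral>\<^sup>+ v. ennreal ((cmod (f v))\<^sup>2) \<partial>count_space ?V)"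
    by (rule nn_integral_cong) (simp add: nn_integral_cmult vertex_mass)
  finally show ?thesis .
qed

text \<open>In the layers of the branches, the products in the amplitudes of consecutive levels differ exactly
  by the weight at the vertex reached. At the root and below it both sides vanish. In the layer \<open>0\<close> the right-hand side
  vanishes because of \<open>\<surd>0 = 0\<close>, the left-hand side because the shift never reaches the root.\<close>

lemma embed_shift:
  assumes f: "\<And>v. v \<notin> tree_V \<eta> \<kappa> \<Longrightarrow> f v = 0"
  shows "AE \<omega> in M. embed (shift_map \<eta> \<kappa> wt f) \<omega> = of_real (sqrt (snd \<omega>)) * embed f (level_shift (-1) \<omega>)"
proof -
  let ?g = "shift_map \<eta> \<kappa> wt f"
  have meas: "Measurable.pred fibre_space (\<lambda>\<omega>. embed ?g \<omega> = of_real (sqrt (snd \<omega>)) * embed f (level_shift (-1) \<omega>))"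
  proof -
    have [measurable]: "(\<lambda>\<omega>. complex_of_real (sqrt (snd \<omega>))) \<in> borel_measurable fibre_space"
      by (rule measurable_fibre_spaceI) simp
    show ?thesis by measurable
  qed
  have "AE s in R (fst p). embed ?g (p, s) = of_real (sqrt (snd (p, s))) * embed f (level_shift (-1) (p, s))" for p :: "nat \<times> int"
  proof -
    obtain i n where p: "p = (i, n)" by (cases p)
    show ?thesis
    proof (cases "i \<in> J \<eta>")
      case True
      have i0: "i \<noteq> 0" using True by (metis zero_notin_J)
      have step: "?g (vertex_at (i, n)) * amplitude (i, n) = f (vertex_at (i, n - 1)) * amplitude (i, n - 1)"
      proof (cases "n \<le> 0")
        case n: True
        define k where "k = nat (- n)"
        have nk: "n = - int k" using n by (simp add: k_def)
        have vk: "vertex_at (i, n) = Trunk k" "vertex_at (i, n - 1) = Trunk (Suc k)"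
          by (auto simp: vertex_at_def nk nat_diff_distrib nat_add_distrib)
        have ak: "amplitude (i, n) = (\<Prod>j<k. wt (Trunk j))" "amplitude (i, n - 1) = (\<Prod>j<k. wt (Trunk j)) * wt (Trunk k)"
          using i0 by (auto simp: amplitude_def nk nat_diff_distrib nat_add_distrib)
        show ?thesis
        proof (cases "enat k < \<kappa>")
          case True
          then show ?thesis
            by (simp add: vk ak shift_map_def Trunk_in_tree_V0 parent_Trunk)
        next
          case False
          then have "f (Trunk (Suc k)) = 0"
            by (intro f) (simp add: Trunk_in_tree_V Suc_ile_eq)
          with False show ?thesis by (simp add: vk shift_map_def Trunk_in_tree_V0)
        qed
      next
        case n: False
        define j where "j = nat n - 1"
        have nj: "n = int (Suc j)" using n by (simp add: j_def)
        have nz: "wt (Branch i (Suc j)) \<noteq> 0"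
          by (rule wt_nonzero) (simp add: Branch_in_tree_V0 True)
        have an: "amplitude (i, n) = 1 / ((\<Prod>m=1..j. wt (Branch i m)) * wt (Branch i (Suc j)))"
          using i0 by (simp add: amplitude_def nj nat_add_distrib)
        have vn: "vertex_at (i, n) = Branch i (Suc j)" by (simp add: vertex_at_def nj)
        show ?thesis
        proof (cases "j = 0")
          case j: True
          have "?g (vertex_at (i, n)) = wt (Branch i 1) * f (Trunk 0)"
            using True parent_Branch_1[OF True, of \<kappa>] by (simp add: vn j shift_map_def Branch_in_tree_V0)
          moreover have "vertex_at (i, n - 1) = Trunk 0" "amplitude (i, n - 1) = 1"
            using i0 by (auto simp: nj j vertex_at_def amplitude_def)
          ultimately show ?thesis using nz by (simp add: an j)
        next
          case j: False
          have "?g (vertex_at (i, n)) = wt (Branch i (Suc j)) * f (Branch i j)"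
            using True j parent_Branch_Suc[OF True, of j \<kappa>] by (simp add: vn shift_map_def Branch_in_tree_V0)
          moreover have "vertex_at (i, n - 1) = Branch i j" "amplitude (i, n - 1) = 1 / (\<Prod>m=1..j. wt (Branch i m))"
            using i0 j by (auto simp: nj vertex_at_def amplitude_def)
          ultimately show ?thesis using nz by (simp add: an)
        qed
      qed
      have "AE s in R i. 0 < s"
      proof -
        note [measurable] = mu_id[OF True]
        have "AE s in density (\<mu> i) (\<lambda>s. ennreal (child_weight i) * (1 / ennreal s)). 0 < s"
          by (subst AE_density) (use AE_pos[OF True] in \<open>auto elim!: eventually_mono\<close>)
        moreover have "R i = density (\<mu> i) (\<lambda>s. ennreal (child_weight i) * (1 / ennreal s))"
          using True by (simp add: R_def)
        ultimately show ?thesis by (simp only:)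
      qed
      then show ?thesis
        unfolding p fst_conv snd_conv
      proof eventually_elim
        case (elim s)
        have "profile i n s = sqrt s * profile i (n - 1) s"
        proof -
          have "s powr (real_of_int n / 2) = s powr (1 / 2 + real_of_int (n - 1) / 2)"
            by (simp add: field_simps)
          also have "\<dots> = sqrt s * s powr (real_of_int (n - 1) / 2)"
            using elim by (simp add: powr_add powr_half_sqrt)
          finally show ?thesis using i0 by (simp add: profile_def)
        qed
        then show ?case using step by (simp add: embed_def level_shift_def mult_ac)
      qed
    next
      case False
      show ?thesis
      proof (cases "i = 0")
        case True
        have "?g (vertex_at (0, n)) * amplitude (0, n) = 0"
        proof (cases "enat (nat (- n)) = \<kappa>")
          case k: True
          have "?g (vertex_at (0, n)) = 0"
          proof (cases "n \<le> 0")
            case True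
            then show ?thesis using k by (auto simp: vertex_at_def shift_map_def Trunk_in_tree_V0)
          qed (simp add: vertex_at_def shift_map_def Branch_in_tree_V0)
          then show ?thesis by simp
        qed (simp add: amplitude_def)
        then have "embed ?g (p, 0) = 0"
          using True p by (simp add: embed_def)
        moreover have "Measurable.pred borel (\<lambda>s. embed ?g (p, s) = of_real (sqrt (snd (p, s))) * embed f (level_shift (-1) (p, s)))"
          by (rule measurable_compose[OF _ meas]) (simp add: fibre_space_def)
        moreover have R0: "R (fst p) = return borel 0" using True p by (simp add: R_def)
        ultimately show ?thesis unfolding R0 by (subst AE_return) simp_all
      next
        case i0: False
        then have R0: "R (fst p) = null_measure borel" using False p by (simp add: R_def)
        show ?thesis unfolding R0 by (rule AE_I[of _ _ UNIV]) simp_all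
      qed
    qed
  qed
  then show ?thesis by (rule AE_M[OF meas])
qed

section \<open>The weighted shift and its normal extension\<close>

lemma shift_map_e0_carrier: "shift_map \<eta> \<kappa> wt (indicator {Trunk 0}) \<in> carrier (ell2 (tree_V \<eta> \<kappa>))"
  using e0_in_Domain by (auto simp: weighted_shift_def)

lemma children_summable: "(\<lambda>v. (cmod (wt v))\<^sup>2) summable_on {Branch i 1 | i. i \<in> J \<eta>}"
proof -
  have "(\<lambda>v. (cmod (shift_map \<eta> \<kappa> wt (indicator {Trunk 0}) v))\<^sup>2) summable_on tree_V \<eta> \<kappa>"
    using shift_map_e0_carrier by (simp add: ell2_def)
  then have "(\<lambda>v. (cmod (shift_map \<eta> \<kappa> wt (indicator {Trunk 0}) v))\<^sup>2) summable_on {Branch i 1 | i. i \<in> J \<eta>}"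
    by (rule summable_on_subset_banach) (auto simp: Branch_in_tree_V)
  also have "?this \<longleftrightarrow> ?thesis"
    by (rule summable_on_cong) (auto simp: shift_map_def Branch_in_tree_V0 parent_Branch_1[simplified])
  finally show ?thesis .
qed

lemma shift_map_off: "v \<notin> tree_V \<eta> \<kappa> \<Longrightarrow> shift_map \<eta> \<kappa> wt f v = 0"
  by (auto simp: shift_map_def tree_V0_def)

text \<open>An inverse of the parent map away from the branching vertex, where children are
  unique.\<close>

definition only_child :: "vertex \<Rightarrow> vertex" where
  "only_child v = (case v of Trunk k \<Rightarrow> Trunk (k - 1) | Branch i j \<Rightarrow> Branch i (Suc j))"

lemma only_child_parent:
  assumes v: "v \<in> tree_V0 \<eta> \<kappa>" "v \<notin> {Branch i 1 | i. i \<in> J \<eta>}"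
  shows "only_child (parent \<eta> \<kappa> v) = v"
proof (cases v)
  case (Trunk k)
  then show ?thesis using v by (simp add: Trunk_in_tree_V0 parent_Trunk only_child_def)
next
  case (Branch i j)
  with v have i: "i \<in> J \<eta>" and j: "1 \<le> j" "j \<noteq> 1" by (auto simp: Branch_in_tree_V0)
  then obtain m where "j = Suc m" "1 \<le> m" by (cases j) auto
  then show ?thesis using Branch parent_Branch_Suc[OF i, of m \<kappa>] by (simp add: only_child_def)
qed

text \<open>A finite set of vertices has only finitely many children apart from those of the branching
  vertex, whose weights are square summable because \<open>e\<close> at the branching vertex lies in the domain.\<close>

lemma finite_support_in_Domain:
  assumes y: "y \<in> carrier (ell2 (tree_V \<eta> \<kappa>))" and F: "finite F" and supp: "\<And>v. v \<notin> F \<Longrightarrow> y v = 0"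
  shows "y \<in> Domain (weighted_shift \<eta> \<kappa> wt)"
proof -
  let ?V = "tree_V \<eta> \<kappa>" and ?B = "{Branch i 1 | i. i \<in> J \<eta>}"
  let ?q = "\<lambda>v. (cmod (shift_map \<eta> \<kappa> wt y v))\<^sup>2"
  have B: "?q summable_on ?B"
  proof -
    have "(\<lambda>v. (cmod (wt v))\<^sup>2 * (cmod (y (Trunk 0)))\<^sup>2) summable_on ?B"
      by (rule summable_on_cmult_left[OF children_summable])
    also have "?this \<longleftrightarrow> ?thesis"
      by (rule summable_on_cong)
        (auto simp: shift_map_def Branch_in_tree_V0 parent_Branch_1[simplified] norm_mult power_mult_distrib)
    finally show ?thesis .
  qed
  have "?q summable_on (only_child ` F - ?B)" using F by (intro summable_on_finite) simp
  then have "?q summable_on (?B \<union> (only_child ` F - ?B))"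
    using B by (intro summable_on_Un_disjoint) auto
  also have "?this \<longleftrightarrow> ?q summable_on ?V"
  proof (rule summable_on_cong_neutral)
    fix v assume "v \<in> (?B \<union> (only_child ` F - ?B)) - ?V"
    then show "?q v = 0" by (simp add: shift_map_off)
  next
    fix v assume v: "v \<in> ?V - (?B \<union> (only_child ` F - ?B))"
    show "?q v = 0"
    proof (cases "v \<in> tree_V0 \<eta> \<kappa>")
      case True
      then have "only_child (parent \<eta> \<kappa> v) = v" using v by (intro only_child_parent) auto
      with v have "parent \<eta> \<kappa> v \<notin> F" by force
      then show ?thesis using supp by (simp add: shift_map_def)
    qed (simp add: shift_map_def)
  qed simp
  finally have "shift_map \<eta> \<kappa> wt y \<in> carrier (ell2 ?V)"
    by (simp add: ell2_def shift_map_off)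
  with y show ?thesis by (auto simp: weighted_shift_def)
qed

lemma shift_densely_defined: "densely_defined (ell2 (tree_V \<eta> \<kappa>)) (weighted_shift \<eta> \<kappa> wt)"
proof -
  interpret H: L2_model "count_space (tree_V \<eta> \<kappa>)" "ell2 (tree_V \<eta> \<kappa>)" "\<lambda>f. f" by (rule L2_model_ell2)
  obtain e :: "vertex \<Rightarrow> nat" where e: "inj e"
    using countable_vertices[of UNIV] by (rule countableE)
  show ?thesis
    unfolding densely_defined_def
  proof (rule H.closure_of_eq_carrier)
    show "Domain (weighted_shift \<eta> \<kappa> wt) \<subseteq> carrier (ell2 (tree_V \<eta> \<kappa>))"
      by (auto simp: weighted_shift_def)
    fix x assume x: "x \<in> carrier (ell2 (tree_V \<eta> \<kappa>))"
    define A where "A n = {v \<in> tree_V \<eta> \<kappa>. e v < n}" for n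
    have fin: "finite (A n)" for n
    proof (rule finite_subset)
      show "A n \<subseteq> e -` {..<n}" by (auto simp: A_def)
      show "finite (e -` {..<n})" using e by (intro finite_vimageI) auto
    qed
    have "A n \<in> sets (count_space (tree_V \<eta> \<kappa>))" for n by (auto simp: A_def)
    moreover have "AE v in count_space (tree_V \<eta> \<kappa>). \<forall>\<^sub>F n in sequentially. v \<in> A n"
      unfolding AE_count_space
    proof
      fix v assume v: "v \<in> tree_V \<eta> \<kappa>"
      show "\<forall>\<^sub>F n in sequentially. v \<in> A n"
        using eventually_gt_at_top[of "e v"] by eventually_elim (simp add: A_def v)
    qed
    moreover have "y \<in> Domain (weighted_shift \<eta> \<kappa> wt)"
      if y: "y \<in> carrier (ell2 (tree_V \<eta> \<kappa>))"
        and eq: "AE v in count_space (tree_V \<eta> \<kappa>). y v = indicator (A n) v * x v" for n y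
    proof (rule finite_support_in_Domain[OF y fin[of n]])
      fix v assume "v \<notin> A n"
      then show "y v = 0" using y eq by (cases "v \<in> tree_V \<eta> \<kappa>") (auto simp: ell2_def AE_count_space)
    qed
    ultimately show "\<exists>A :: nat \<Rightarrow> vertex set. (\<forall>n. A n \<in> sets (count_space (tree_V \<eta> \<kappa>))) \<and>
        (AE v in count_space (tree_V \<eta> \<kappa>). \<forall>\<^sub>F n in sequentially. v \<in> A n) \<and>
        (\<forall>n. \<forall>y\<in>carrier (ell2 (tree_V \<eta> \<kappa>)). (AE v in count_space (tree_V \<eta> \<kappa>). y v = indicator (A n) v * x v)
          \<longrightarrow> y \<in> Domain (weighted_shift \<eta> \<kappa> wt))"
      by (intro exI[of _ A]) simp
  qed
qed

lemma shift_linear: "linear_operator (ell2 (tree_V \<eta> \<kappa>)) (weighted_shift \<eta> \<kappa> wt)"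
proof -
  interpret H: L2_model "count_space (tree_V \<eta> \<kappa>)" "ell2 (tree_V \<eta> \<kappa>)" "\<lambda>f. f" by (rule L2_model_ell2)
  let ?H = "ell2 (tree_V \<eta> \<kappa>)" and ?L = "shift_map \<eta> \<kappa> wt"
  have add: "?L (x \<oplus>\<^bsub>?H\<^esub> y) = ?L x \<oplus>\<^bsub>?H\<^esub> ?L y" for x y
    by (auto simp: ell2_def shift_map_def algebra_simps)
  have scale: "?L (c \<odot>\<^bsub>?H\<^esub> x) = c \<odot>\<^bsub>?H\<^esub> ?L x" for c x
    by (auto simp: ell2_def shift_map_def)
  have zero: "?L \<zero>\<^bsub>?H\<^esub> = \<zero>\<^bsub>?H\<^esub>"
    by (auto simp: ell2_def shift_map_def)
  show ?thesis
    unfolding linear_operator_def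
  proof (intro conjI allI impI)
    show "weighted_shift \<eta> \<kappa> wt \<subseteq> carrier ?H \<times> carrier ?H" by (auto simp: weighted_shift_def)
    show "single_valued (weighted_shift \<eta> \<kappa> wt)" by (auto simp: weighted_shift_def single_valued_def)
    show "(\<zero>\<^bsub>?H\<^esub>, \<zero>\<^bsub>?H\<^esub>) \<in> weighted_shift \<eta> \<kappa> wt"
      using zero H.zero_closed' by (auto simp: weighted_shift_def)
  next
    fix x y x' y'
    assume "(x, y) \<in> weighted_shift \<eta> \<kappa> wt" "(x', y') \<in> weighted_shift \<eta> \<kappa> wt"
    then show "(x \<oplus>\<^bsub>?H\<^esub> x', y \<oplus>\<^bsub>?H\<^esub> y') \<in> weighted_shift \<eta> \<kappa> wt"
      using add[of x x'] by (simp add: weighted_shift_def H.add_closed')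
  next
    fix c x y
    assume "(x, y) \<in> weighted_shift \<eta> \<kappa> wt"
    then show "(c \<odot>\<^bsub>?H\<^esub> x, c \<odot>\<^bsub>?H\<^esub> y) \<in> weighted_shift \<eta> \<kappa> wt"
      using scale[of c x] by (simp add: weighted_shift_def H.scale_closed)
  qed
qed

theorem subnormal: "subnormal_operator (ell2 (tree_V \<eta> \<kappa>)) (weighted_shift \<eta> \<kappa> wt)"
proof -
  let ?V = "tree_V \<eta> \<kappa>"
  let ?H = "ell2 ?V"
  interpret H: L2_model "count_space ?V" ?H "\<lambda>f. f" by (rule L2_model_ell2)
  obtain dec :: "(vertex \<Rightarrow> complex) set \<Rightarrow> ((nat \<times> int) \<times> real \<Rightarrow> complex)" where dec: "surj dec"
    using surj_decoding by blast
  let ?K = "L2_space M dec"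
  interpret K: weighted_composition M ?K dec "level_shift (-1)" "level_shift 1" "\<lambda>\<omega>. sqrt (snd \<omega>)"
    by (rule weighted_composition_level_shift[OF dec])
  have off: "f v = 0" if "f \<in> carrier ?H" "v \<notin> ?V" for f v using that by (simp add: ell2_def)
  have norm: "(\<integral>\<^sup>+ \<omega>. ennreal ((cmod (embed f \<omega>))\<^sup>2) \<partial>M) = ennreal ((L2_norm (count_space ?V) f)\<^sup>2)"
    if "f \<in> carrier ?H" for f
    using nn_integral_embed[OF off[OF that]] nn_integral_L2_norm[OF H.dec_square_integrable[OF that]] by simp
  have embed_meas: "embed f \<in> borel_measurable M" for f
    using embed_measurable[of f] by (simp cong: measurable_cong_sets)
  have sq: "square_integrable M (embed f)" if "f \<in> carrier ?H" for f
    using norm[OF that] embed_meas by (simp add: square_integrable_iff_nn)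
  have "\<forall>f\<in>carrier ?H. \<exists>u. u \<in> carrier ?K \<and> (AE \<omega> in M. dec u \<omega> = embed f \<omega>)"
    using K.dec_surj[OF sq] by blast
  then obtain U where U: "\<And>f. f \<in> carrier ?H \<Longrightarrow> U f \<in> carrier ?K"
    and dec_U: "\<And>f. f \<in> carrier ?H \<Longrightarrow> AE \<omega> in M. dec (U f) \<omega> = embed f \<omega>"
    by metis
  have "hilbert_isometry ?H ?K U"
  proof (rule hilbert_isometryI[OF H.L2_model_axioms K.L2_model_axioms])
    show "U \<in> carrier ?H \<rightarrow> carrier ?K" using U by blast
  next
    fix f g assume f: "f \<in> carrier ?H" and g: "g \<in> carrier ?H"
    note fg = H.add_closed'[OF f g]
    show "U (f \<oplus>\<^bsub>?H\<^esub> g) = U f \<oplus>\<^bsub>?K\<^esub> U g"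
    proof (rule K.dec_inj)
      have embed: "embed (f \<oplus>\<^bsub>?H\<^esub> g) \<omega> = embed f \<omega> + embed g \<omega>" for \<omega>
        by (simp add: embed_def ell2_def algebra_simps)
      show "AE \<omega> in M. dec (U (f \<oplus>\<^bsub>?H\<^esub> g)) \<omega> = dec (U f \<oplus>\<^bsub>?K\<^esub> U g) \<omega>"
        using dec_U[OF f] dec_U[OF g] dec_U[OF fg] K.dec_add[OF U[OF f] U[OF g]]
        by eventually_elim (simp add: embed)
    qed (use U f g fg in \<open>auto intro: K.add_closed'\<close>)
  next
    fix c f assume f: "f \<in> carrier ?H"
    note cf = H.scale_closed[OF f, of c]
    show "U (c \<odot>\<^bsub>?H\<^esub> f) = c \<odot>\<^bsub>?K\<^esub> U f"
    proof (rule K.dec_inj)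
      have embed: "embed (c \<odot>\<^bsub>?H\<^esub> f) \<omega> = c * embed f \<omega>" for \<omega>
        by (simp add: embed_def ell2_def algebra_simps)
      show "AE \<omega> in M. dec (U (c \<odot>\<^bsub>?H\<^esub> f)) \<omega> = dec (c \<odot>\<^bsub>?K\<^esub> U f) \<omega>"
        using dec_U[OF f] dec_U[OF cf] K.dec_scale[OF U[OF f], of c]
        by eventually_elim (simp add: embed)
    qed (use U f cf in \<open>auto intro: K.scale_closed\<close>)
  next
    fix f assume f: "f \<in> carrier ?H"
    have "L2_norm M (dec (U f)) = L2_norm M (embed f)"
      by (rule L2_norm_cong_AE) (use dec_U[OF f] U[OF f] embed_meas in auto)
    moreover have "(L2_norm M (embed f))\<^sup>2 = (L2_norm (count_space ?V) f)\<^sup>2"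
      using norm[OF f] nn_integral_L2_norm[OF sq[OF f]] by simp
    ultimately show "L2_norm M (dec (U f)) = L2_norm (count_space ?V) f" by simp
  qed
  moreover have "(U f, U g) \<in> K.wcomp" if "(f, g) \<in> weighted_shift \<eta> \<kappa> wt" for f g
  proof -
    have f: "f \<in> carrier ?H" and g: "g \<in> carrier ?H" and g_eq: "g = shift_map \<eta> \<kappa> wt f"
      using that by (auto simp: weighted_shift_def)
    have "AE \<omega> in M. embed g \<omega> = of_real (sqrt (snd \<omega>)) * embed f (level_shift (-1) \<omega>)"
      unfolding g_eq by (rule embed_shift) (rule off[OF f])
    with dec_U[OF g] K.AE_comp[OF dec_U[OF f]]
    have "AE \<omega> in M. dec (U g) \<omega> = of_real (sqrt (snd \<omega>)) * dec (U f) (level_shift (-1) \<omega>)"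
      by eventually_elim simp
    then show ?thesis using U[OF f] U[OF g] by (simp add: K.wcomp_def)
  qed
  ultimately show ?thesis
    unfolding subnormal_operator_def
    using H.complex_hilbert_space K.complex_hilbert_space shift_linear shift_densely_defined K.wcomp_normal
    by (intro conjI exI[of _ ?K] exI[of _ U] exI[of _ K.wcomp]) auto
qed

end

section \<open>Reduction of the four conditions\<close>

lemma one_divide_power_Suc_ennreal: "1 / (x :: ennreal) ^ (l + 1) = 1 / x * (1 / x ^ l)"
  unfolding divide_ennreal_def mult_1_left ennreal_inverse_power by simp

text \<open>The hypothesis on \<open>\<sigma>\<close> is an equality of measures, \<open>s\<^sup>k d\<nu> = C \<Sum>\<^sub>i |\<lambda>\<^sub>i\<^sub>,\<^sub>1|\<^sup>2 s\<^sup>-\<^sup>1 d\<mu>\<^sub>i\<close> with \<open>C\<close> the squared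
  modulus of the product of all trunk weights. Integrating \<open>s\<^sup>-\<^sup>l\<close> against it yields the moment of
  order \<open>k - l\<close> of \<open>\<nu>\<close>. For \<open>l = k\<close> it yields the mass of \<open>\<nu>\<close> outside \<open>0\<close>, and this is
  where only an inequality remains.\<close>

lemma trunk_mass_of_root_measure:
  assumes \<eta>: "2 \<le> \<eta>"
    and wt: "\<And>j. j < k \<Longrightarrow> wt (Trunk j) \<noteq> 0"
    and mu: "\<And>i. i \<in> J \<eta> \<Longrightarrow> borel_prob_Rplus (\<mu> i)"
    and nu: "borel_prob_Rplus \<nu>"
    and nu_moments: "\<And>n. n \<in> J (enat k) \<Longrightarrow>
        (\<integral>\<^sup>+ s. ennreal s ^ n \<partial>\<nu>) = ennreal ((cmod (\<Prod>j=k-n..k-1. wt (Trunk j)))\<^sup>2)"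
    and nu_eq: "\<And>\<sigma>. \<sigma> \<in> sets borel_Rplus \<Longrightarrow>
        (\<integral>\<^sup>+ s\<in>\<sigma>. ennreal s ^ k \<partial>\<nu>) = ennreal ((cmod (\<Prod>j=0..k-1. wt (Trunk j)))\<^sup>2) *
          (\<Sum>\<^sub>\<infinity>i\<in>J \<eta>. ennreal ((cmod (wt (Branch i 1)))\<^sup>2) * (\<integral>\<^sup>+ s\<in>\<sigma>. 1 / ennreal s \<partial>\<mu> i))"
    and k: "0 < k"
  shows "l < k \<Longrightarrow> trunk_mass \<eta> wt \<mu> l = 1" and "trunk_mass \<eta> wt \<mu> k \<le> 1"
proof -
  define a where "a i = ennreal ((cmod (wt (Branch i 1)))\<^sup>2)" for i
  define C where "C = ennreal ((cmod (\<Prod>j=0..k-1. wt (Trunk j)))\<^sup>2)"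
  have upto: "{0..k-1} = {..<k}" using k by auto
  have C_less: "C = ennreal ((cmod (\<Prod>j<k. wt (Trunk j)))\<^sup>2)" by (simp only: C_def upto)
  have C: "C \<noteq> 0" "C \<noteq> \<infinity>" using wt by (auto simp: C_less)
  have sets_mu: "sets (\<mu> i) = sets borel_Rplus" if "i \<in> J \<eta>" for i
    using mu[OF that] by (simp add: borel_prob_Rplus_def)
  have mu_id: "(\<lambda>s. s) \<in> measurable (\<mu> i) borel" if "i \<in> J \<eta>" for i
    unfolding measurable_cong_sets[OF sets_mu[OF that] refl] by (rule measurable_restrict_space1) simp
  have sets_nu [simp]: "sets \<nu> = sets borel_Rplus" using nu by (simp add: borel_prob_Rplus_def)
  have nu_id [measurable]: "(\<lambda>s. s) \<in> measurable \<nu> borel"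
    unfolding measurable_cong_sets[OF sets_nu refl] by (rule measurable_restrict_space1) simp
  have space_nu: "space \<nu> = {0..}"
    using sets_eq_imp_space_eq[OF sets_nu] by (simp add: space_restrict_space)
  have space_mu: "space (\<mu> i) = {0..}" if "i \<in> J \<eta>" for i
    using sets_eq_imp_space_eq[OF sets_mu[OF that]] by (simp add: space_restrict_space)
  interpret nu: prob_space \<nu> using nu by (simp add: borel_prob_Rplus_def)
  define D where "D i = density (\<mu> i) (\<lambda>s. a i * (1 / ennreal s))" for i
  have nn_D: "(\<integral>\<^sup>+ s. g s \<partial>D i) = a i * (\<integral>\<^sup>+ s. 1 / ennreal s * g s \<partial>\<mu> i)"
    if i: "i \<in> J \<eta>" and g: "g \<in> borel_measurable borel_Rplus" for i g
  proof -
    note [measurable] = mu_id[OF i]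
    have [measurable]: "g \<in> borel_measurable (\<mu> i)"
      using g measurable_cong_sets[OF sets_mu[OF i] refl] by blast
    show ?thesis
      by (simp add: D_def nn_integral_density nn_integral_cmult mult.assoc)
  qed
  have emeasure_D: "emeasure (D i) \<sigma> = a i * (\<integral>\<^sup>+ s\<in>\<sigma>. 1 / ennreal s \<partial>\<mu> i)"
    if i: "i \<in> J \<eta>" and \<sigma>: "\<sigma> \<in> sets borel_Rplus" for i \<sigma>
  proof -
    have "emeasure (D i) \<sigma> = (\<integral>\<^sup>+ s. indicator \<sigma> s \<partial>D i)"
      using \<sigma> sets_mu[OF i] by (simp add: D_def)
    also have "\<dots> = a i * (\<integral>\<^sup>+ s\<in>\<sigma>. 1 / ennreal s \<partial>\<mu> i)"
      by (rule nn_D[OF i]) (use \<sigma> in measurable)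
    finally show ?thesis .
  qed
  have total: "(\<integral>\<^sup>+ i. a i * (\<integral>\<^sup>+ s. 1 / ennreal s \<partial>\<mu> i) \<partial>count_space (J \<eta>)) = 1"
  proof -
    have R: "{0..} \<in> sets borel_Rplus" using sets.top[of borel_Rplus] by (simp add: space_restrict_space)
    have "(\<integral>\<^sup>+ s\<in>{0..}. ennreal s ^ k \<partial>\<nu>) = (\<integral>\<^sup>+ s. ennreal s ^ k \<partial>\<nu>)"
      by (rule nn_integral_cong) (simp add: space_nu)
    moreover have "(\<integral>\<^sup>+ s. ennreal s ^ k \<partial>\<nu>) = C"
      using nu_moments[of k] k by (simp add: C_def J_def)
    moreover have "(\<integral>\<^sup>+ i. a i * (\<integral>\<^sup>+ s\<in>{0..}. 1 / ennreal s \<partial>\<mu> i) \<partial>count_space (J \<eta>))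
        = (\<integral>\<^sup>+ i. a i * (\<integral>\<^sup>+ s. 1 / ennreal s \<partial>\<mu> i) \<partial>count_space (J \<eta>))"
    proof (rule nn_integral_cong)
      fix i assume "i \<in> space (count_space (J \<eta>))"
      then have "(\<integral>\<^sup>+ s\<in>{0..}. 1 / ennreal s \<partial>\<mu> i) = (\<integral>\<^sup>+ s. 1 / ennreal s \<partial>\<mu> i)"
        by (intro nn_integral_cong) (simp add: space_mu)
      then show "a i * (\<integral>\<^sup>+ s\<in>{0..}. 1 / ennreal s \<partial>\<mu> i) = a i * (\<integral>\<^sup>+ s. 1 / ennreal s \<partial>\<mu> i)"
        by (simp only:)
    qed
    ultimately have "C * 1 = C * (\<integral>\<^sup>+ i. a i * (\<integral>\<^sup>+ s. 1 / ennreal s \<partial>\<mu> i) \<partial>count_space (J \<eta>))"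
      using nu_eq[OF R, folded C_def] unfolding infsum_ennreal_nat a_def by simp
    then show ?thesis using C unfolding ennreal_mult_cancel_left by auto
  qed
  have kernel: "D \<in> measurable (count_space (J \<eta>)) (subprob_algebra borel_Rplus)"
  proof (rule measurable_count_space_eq1[THEN iffD2], rule funcsetI)
    fix i assume i: "i \<in> J \<eta>"
    have sp: "space (D i) = {0..}" using space_mu[OF i] by (simp add: D_def)
    have R: "{0..} \<in> sets borel_Rplus" using sets.top[of borel_Rplus] by (simp add: space_restrict_space)
    have "emeasure (D i) (space (D i)) = a i * (\<integral>\<^sup>+ s. 1 / ennreal s \<partial>\<mu> i)"
      unfolding sp emeasure_D[OF i R]
      by (intro arg_cong[where f = "\<lambda>x. a i * x"] nn_integral_cong) (simp add: space_mu[OF i])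
    also have "\<dots> \<le> 1"
      using nn_integral_ge_point[OF i, of "\<lambda>i. a i * (\<integral>\<^sup>+ s. 1 / ennreal s \<partial>\<mu> i)"] total by simp
    finally show "D i \<in> space (subprob_algebra borel_Rplus)"
      using sp sets_mu[OF i] by (auto simp: space_subprob_algebra D_def intro!: subprob_spaceI)
  qed
  \<comment> \<open>\<open>total\<close> makes every \<open>D i\<close> a subprobability measure, so that \<open>B\<close> is the sum of the \<open>D i\<close>.\<close>
  define B where "B = count_space (J \<eta>) \<bind> D"
  have ne: "J \<eta> \<noteq> {}"
  proof -
    have "enat 1 \<le> \<eta>" using \<eta> by (cases \<eta>) (auto simp: numeral_eq_enat)
    then show ?thesis by (auto simp: J_def)
  qed
  have sets_B: "sets B = sets borel_Rplus"
    unfolding B_def by (rule sets_bind) (use sets_mu ne in \<open>auto simp: D_def\<close>)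
  have "density \<nu> (\<lambda>s. ennreal s ^ k) = scale_measure C B"
  proof (rule measure_eqI)
    show "sets (density \<nu> (\<lambda>s. ennreal s ^ k)) = sets (scale_measure C B)" using sets_B by simp
    fix \<sigma> assume "\<sigma> \<in> sets (density \<nu> (\<lambda>s. ennreal s ^ k))"
    then have \<sigma>: "\<sigma> \<in> sets borel_Rplus" by simp
    have "emeasure B \<sigma> = (\<integral>\<^sup>+ i. emeasure (D i) \<sigma> \<partial>count_space (J \<eta>))"
      unfolding B_def by (rule emeasure_bind[OF _ kernel \<sigma>]) (use ne in simp)
    also have "\<dots> = (\<integral>\<^sup>+ i. a i * (\<integral>\<^sup>+ s\<in>\<sigma>. 1 / ennreal s \<partial>\<mu> i) \<partial>count_space (J \<eta>))"
      by (rule nn_integral_cong) (simp add: emeasure_D \<sigma>)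
    finally show "emeasure (density \<nu> (\<lambda>s. ennreal s ^ k)) \<sigma> = emeasure (scale_measure C B) \<sigma>"
      using nu_eq[OF \<sigma>] \<sigma>
      by (simp add: emeasure_density C_def a_def infsum_ennreal_nat)
  qed
  then have int: "(\<integral>\<^sup>+ s. ennreal s ^ k * g s \<partial>\<nu>) = C * (\<integral>\<^sup>+ i. a i * (\<integral>\<^sup>+ s. 1 / ennreal s * g s \<partial>\<mu> i) \<partial>count_space (J \<eta>))"
    if g: "g \<in> borel_measurable borel_Rplus" for g
  proof -
    have [measurable]: "g \<in> borel_measurable \<nu>"
      using g measurable_cong_sets[OF sets_nu refl] by blast
    have gB: "g \<in> borel_measurable B" using g measurable_cong_sets[OF sets_B refl] by blast
    have "(\<integral>\<^sup>+ s. ennreal s ^ k * g s \<partial>\<nu>) = (\<integral>\<^sup>+ s. g s \<partial>density \<nu> (\<lambda>s. ennreal s ^ k))"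
      by (simp add: nn_integral_density)
    also have "\<dots> = (\<integral>\<^sup>+ s. g s \<partial>scale_measure C B)"
      using \<open>density \<nu> (\<lambda>s. ennreal s ^ k) = scale_measure C B\<close> by simp
    also have "\<dots> = C * (\<integral>\<^sup>+ s. g s \<partial>B)" by (rule nn_integral_scale_measure[OF gB])
    also have "(\<integral>\<^sup>+ s. g s \<partial>B) = (\<integral>\<^sup>+ i. (\<integral>\<^sup>+ s. g s \<partial>D i) \<partial>count_space (J \<eta>))"
      unfolding B_def by (rule nn_integral_bind[OF g kernel])
    also have "\<dots> = (\<integral>\<^sup>+ i. a i * (\<integral>\<^sup>+ s. 1 / ennreal s * g s \<partial>\<mu> i) \<partial>count_space (J \<eta>))"
      by (rule nn_integral_cong) (simp add: nn_D g)
    finally show ?thesis .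
  qed
  define S where "S l = (\<integral>\<^sup>+ i. a i * (\<integral>\<^sup>+ s. 1 / ennreal s ^ (l + 1) \<partial>\<mu> i) \<partial>count_space (J \<eta>))" for l
  have tm: "trunk_mass \<eta> wt \<mu> l = ennreal ((cmod (\<Prod>j<l. wt (Trunk j)))\<^sup>2) * S l" for l
    by (simp add: trunk_mass_def S_def a_def infsum_ennreal_nat)
  have int_l: "C * S l = (\<integral>\<^sup>+ s. ennreal s ^ k * (1 / ennreal s ^ l) \<partial>\<nu>)" for l
  proof -
    have "(\<lambda>s. 1 / ennreal s ^ l) \<in> borel_measurable borel_Rplus"
      by (rule measurable_restrict_space1) measurable
    from int[OF this] show ?thesis
      by (simp only: S_def one_divide_power_Suc_ennreal)
  qed
  show "trunk_mass \<eta> wt \<mu> l = 1" if l: "l < k"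
  proof -
    have "C * S l = (\<integral>\<^sup>+ s. ennreal s ^ (k - l) \<partial>\<nu>)"
      unfolding int_l
    proof (rule nn_integral_cong)
      fix s assume "s \<in> space \<nu>"
      then have "0 \<le> s" by (simp add: space_nu)
      show "ennreal s ^ k * (1 / ennreal s ^ l) = ennreal s ^ (k - l)"
      proof (cases "s = 0")
        case True
        then show ?thesis using l by (simp add: power_0_left)
      next
        case False
        have "ennreal s ^ k = ennreal s ^ (k - l) * ennreal s ^ l"
          using l by (simp add: power_add[symmetric])
        then show ?thesis using False \<open>0 \<le> s\<close>
          by (simp add: ennreal_power divide_ennreal_def mult.assoc ennreal_inverse_power[symmetric]
              inverse_ennreal ennreal_mult[symmetric])
      qed
    qed
    also have "\<dots> = ennreal ((cmod (\<Prod>j=l..k-1. wt (Trunk j)))\<^sup>2)"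
      using nu_moments[of "k - l"] l by (simp add: J_def)
    also have "C * S l = ennreal ((cmod (\<Prod>j=l..k-1. wt (Trunk j)))\<^sup>2) * trunk_mass \<eta> wt \<mu> l"
    proof -
      have "{..<k} = {..<l} \<union> {l..k-1}" "{..<l} \<inter> {l..k-1} = {}" using l by auto
      then have "(\<Prod>j<k. wt (Trunk j)) = (\<Prod>j<l. wt (Trunk j)) * (\<Prod>j=l..k-1. wt (Trunk j))"
        by (simp add: prod.union_disjoint)
      then show ?thesis
        by (simp add: C_less tm norm_mult power_mult_distrib ennreal_mult mult_ac)
    qed
    finally have "ennreal ((cmod (\<Prod>j=l..k-1. wt (Trunk j)))\<^sup>2) * trunk_mass \<eta> wt \<mu> l
        = ennreal ((cmod (\<Prod>j=l..k-1. wt (Trunk j)))\<^sup>2) * 1" by simp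
    moreover have "(\<Prod>j=l..k-1. wt (Trunk j)) \<noteq> 0" using wt k by auto
    ultimately show ?thesis unfolding ennreal_mult_cancel_left by auto
  qed
  show "trunk_mass \<eta> wt \<mu> k \<le> 1"
  proof -
    have "trunk_mass \<eta> wt \<mu> k = (\<integral>\<^sup>+ s. ennreal s ^ k * (1 / ennreal s ^ k) \<partial>\<nu>)"
      unfolding tm int_l[symmetric] C_less ..
    also have "\<dots> \<le> (\<integral>\<^sup>+ s. 1 \<partial>\<nu>)"
    proof (rule nn_integral_mono)
      fix s assume "s \<in> space \<nu>"
      then have "0 \<le> s" by (simp add: space_nu)
      then show "ennreal s ^ k * (1 / ennreal s ^ k) \<le> 1"
        using k by (cases "s = 0")
          (simp_all add: power_0_left ennreal_power divide_ennreal_def inverse_ennreal ennreal_mult[symmetric])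
    qed
    also have "\<dots> = 1" by (simp add: nu.emeasure_space_1)
    finally show ?thesis .
  qed
qed

theorem theorem4p1:
  fixes \<eta> \<kappa> :: enat
    and wt :: "vertex \<Rightarrow> complex"
    and \<mu> :: "nat \<Rightarrow> real measure"
  assumes "2 \<le> \<eta>"
    and "\<And>v. v \<in> tree_V0 \<eta> \<kappa> \<Longrightarrow> wt v \<noteq> 0"
    and "indicator {Trunk 0} \<in> smooth_domain (weighted_shift \<eta> \<kappa> wt)"
    and "\<And>i. i \<in> J \<eta> \<Longrightarrow> borel_prob_Rplus (\<mu> i)"
    and "\<And>n i. 1 \<le> n \<Longrightarrow> i \<in> J \<eta> \<Longrightarrow>
           (\<integral>\<^sup>+ s. ennreal s ^ n \<partial>\<mu> i) = ennreal ((cmod (\<Prod>j=2..n+1. wt (Branch i j)))\<^sup>2)"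
    and "(\<kappa> = 0 \<and>
            (\<Sum>\<^sub>\<infinity>i\<in>J \<eta>. ennreal ((cmod (wt (Branch i 1)))\<^sup>2) * (\<integral>\<^sup>+ s. 1 / ennreal s \<partial>\<mu> i)) \<le> 1)
       \<or> (\<exists>k. \<kappa> = enat k \<and> 0 < k \<and>
            (\<Sum>\<^sub>\<infinity>i\<in>J \<eta>. ennreal ((cmod (wt (Branch i 1)))\<^sup>2) * (\<integral>\<^sup>+ s. 1 / ennreal s \<partial>\<mu> i)) = 1 \<and>
            (\<forall>l \<in> J (enat (k - 1)).
               ennreal ((cmod (\<Prod>j=0..l-1. wt (Trunk j)))\<^sup>2) *
               (\<Sum>\<^sub>\<infinity>i\<in>J \<eta>. ennreal ((cmod (wt (Branch i 1)))\<^sup>2) *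
                  (\<integral>\<^sup>+ s. 1 / ennreal s ^ (l + 1) \<partial>\<mu> i)) = 1) \<and>
            ennreal ((cmod (\<Prod>j=0..k-1. wt (Trunk j)))\<^sup>2) *
              (\<Sum>\<^sub>\<infinity>i\<in>J \<eta>. ennreal ((cmod (wt (Branch i 1)))\<^sup>2) *
                 (\<integral>\<^sup>+ s. 1 / ennreal s ^ (k + 1) \<partial>\<mu> i)) \<le> 1)
       \<or> (\<exists>k. \<kappa> = enat k \<and> 0 < k \<and>
            (\<exists>\<nu>. borel_prob_Rplus \<nu> \<and>
               (\<forall>n \<in> J (enat k).
                  (\<integral>\<^sup>+ s. ennreal s ^ n \<partial>\<nu>) = ennreal ((cmod (\<Prod>j=k-n..k-1. wt (Trunk j)))\<^sup>2)) \<and>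
               (\<forall>\<sigma> \<in> sets borel_Rplus.
                  (\<integral>\<^sup>+ s\<in>\<sigma>. ennreal s ^ k \<partial>\<nu>) =
                  ennreal ((cmod (\<Prod>j=0..k-1. wt (Trunk j)))\<^sup>2) *
                  (\<Sum>\<^sub>\<infinity>i\<in>J \<eta>. ennreal ((cmod (wt (Branch i 1)))\<^sup>2) *
                     (\<integral>\<^sup>+ s\<in>\<sigma>. 1 / ennreal s \<partial>\<mu> i)))))
       \<or> (\<kappa> = \<infinity> \<and>
            (\<Sum>\<^sub>\<infinity>i\<in>J \<eta>. ennreal ((cmod (wt (Branch i 1)))\<^sup>2) * (\<integral>\<^sup>+ s. 1 / ennreal s \<partial>\<mu> i)) = 1 \<and>
            (\<forall>l\<ge>1.
               ennreal ((cmod (\<Prod>j=0..l-1. wt (Trunk j)))\<^sup>2) *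
               (\<Sum>\<^sub>\<infinity>i\<in>J \<eta>. ennreal ((cmod (wt (Branch i 1)))\<^sup>2) *
                  (\<integral>\<^sup>+ s. 1 / ennreal s ^ (l + 1) \<partial>\<mu> i)) = 1))"
  shows "subnormal_operator (ell2 (tree_V \<eta> \<kappa>)) (weighted_shift \<eta> \<kappa> wt)"
proof -
  have upto: "{0..l-1} = {..<l}" if "1 \<le> l" for l :: nat using that by auto
  have tm0: "trunk_mass \<eta> wt \<mu> 0 =
      (\<Sum>\<^sub>\<infinity>i\<in>J \<eta>. ennreal ((cmod (wt (Branch i 1)))\<^sup>2) * (\<integral>\<^sup>+ s. 1 / ennreal s \<partial>\<mu> i))"
    by (simp add: trunk_mass_def)
  have tm: "trunk_mass \<eta> wt \<mu> l = ennreal ((cmod (\<Prod>j=0..l-1. wt (Trunk j)))\<^sup>2) *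
      (\<Sum>\<^sub>\<infinity>i\<in>J \<eta>. ennreal ((cmod (wt (Branch i 1)))\<^sup>2) * (\<integral>\<^sup>+ s. 1 / ennreal s ^ (l + 1) \<partial>\<mu> i))"
    if "1 \<le> l" for l
    by (simp only: trunk_mass_def upto[OF that])
  have "(\<forall>l. enat l < \<kappa> \<longrightarrow> trunk_mass \<eta> wt \<mu> l = 1) \<and> (\<forall>k. \<kappa> = enat k \<longrightarrow> trunk_mass \<eta> wt \<mu> k \<le> 1)"
    using assms(6)
  proof (elim disjE exE conjE)
    assume "\<kappa> = 0"
      "(\<Sum>\<^sub>\<infinity>i\<in>J \<eta>. ennreal ((cmod (wt (Branch i 1)))\<^sup>2) * (\<integral>\<^sup>+ s. 1 / ennreal s \<partial>\<mu> i)) \<le> 1"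
    then show ?thesis using tm0 by (auto simp: zero_enat_def)
  next
    fix k
    assume k: "\<kappa> = enat k" "0 < k"
      and 0: "(\<Sum>\<^sub>\<infinity>i\<in>J \<eta>. ennreal ((cmod (wt (Branch i 1)))\<^sup>2) * (\<integral>\<^sup>+ s. 1 / ennreal s \<partial>\<mu> i)) = 1"
      and l: "\<forall>l \<in> J (enat (k - 1)).
               ennreal ((cmod (\<Prod>j=0..l-1. wt (Trunk j)))\<^sup>2) *
               (\<Sum>\<^sub>\<infinity>i\<in>J \<eta>. ennreal ((cmod (wt (Branch i 1)))\<^sup>2) *
                  (\<integral>\<^sup>+ s. 1 / ennreal s ^ (l + 1) \<partial>\<mu> i)) = 1"
      and le: "ennreal ((cmod (\<Prod>j=0..k-1. wt (Trunk j)))\<^sup>2) *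
              (\<Sum>\<^sub>\<infinity>i\<in>J \<eta>. ennreal ((cmod (wt (Branch i 1)))\<^sup>2) *
                 (\<integral>\<^sup>+ s. 1 / ennreal s ^ (k + 1) \<partial>\<mu> i)) \<le> 1"
    have "trunk_mass \<eta> wt \<mu> l = 1" if "l < k" for l
    proof (cases "l = 0")
      case True
      then show ?thesis using 0 tm0 by simp
    next
      case False
      then show ?thesis using l that tm[of l] by (simp add: J_def)
    qed
    moreover have "trunk_mass \<eta> wt \<mu> k \<le> 1" using le tm[of k] k by simp
    ultimately show ?thesis using k by simp
  next
    fix k \<nu>
    assume k: "\<kappa> = enat k" "0 < k" and nu: "borel_prob_Rplus \<nu>"
      and n: "\<forall>n \<in> J (enat k).
                  (\<integral>\<^sup>+ s. ennreal s ^ n \<partial>\<nu>) = ennreal ((cmod (\<Prod>j=k-n..k-1. wt (Trunk j)))\<^sup>2)"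
      and eq: "\<forall>\<sigma> \<in> sets borel_Rplus.
                  (\<integral>\<^sup>+ s\<in>\<sigma>. ennreal s ^ k \<partial>\<nu>) =
                  ennreal ((cmod (\<Prod>j=0..k-1. wt (Trunk j)))\<^sup>2) *
                  (\<Sum>\<^sub>\<infinity>i\<in>J \<eta>. ennreal ((cmod (wt (Branch i 1)))\<^sup>2) *
                     (\<integral>\<^sup>+ s\<in>\<sigma>. 1 / ennreal s \<partial>\<mu> i))"
    have wt: "wt (Trunk j) \<noteq> 0" if "j < k" for j
      using that k by (intro assms(2)) (simp add: Trunk_in_tree_V0)
    note tr = trunk_mass_of_root_measure[OF assms(1) wt assms(4) nu n[rule_format] eq[rule_format] k(2)]
    from tr k show ?thesis by simp
  next
    assume k: "\<kappa> = \<infinity>"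
      and 0: "(\<Sum>\<^sub>\<infinity>i\<in>J \<eta>. ennreal ((cmod (wt (Branch i 1)))\<^sup>2) * (\<integral>\<^sup>+ s. 1 / ennreal s \<partial>\<mu> i)) = 1"
      and l: "\<forall>l\<ge>1.
               ennreal ((cmod (\<Prod>j=0..l-1. wt (Trunk j)))\<^sup>2) *
               (\<Sum>\<^sub>\<infinity>i\<in>J \<eta>. ennreal ((cmod (wt (Branch i 1)))\<^sup>2) *
                  (\<integral>\<^sup>+ s. 1 / ennreal s ^ (l + 1) \<partial>\<mu> i)) = 1"
    have "trunk_mass \<eta> wt \<mu> l = 1" for l
    proof (cases "l = 0")
      case True
      then show ?thesis using 0 tm0 by simp
    next
      case False
      then show ?thesis using l tm[of l] by simp
    qed
    then show ?thesis using k by simp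
  qed
  then have mass: "\<And>l. enat l < \<kappa> \<Longrightarrow> trunk_mass \<eta> wt \<mu> l = 1"
    "\<And>k. \<kappa> = enat k \<Longrightarrow> trunk_mass \<eta> wt \<mu> k \<le> 1" by blast+
  have "indicator {Trunk 0} \<in> Domain (weighted_shift \<eta> \<kappa> wt ^^ 1)"
    using assms(3) unfolding smooth_domain_def by (rule INT_D) simp
  then have e0: "indicator {Trunk 0} \<in> Domain (weighted_shift \<eta> \<kappa> wt)" by simp
  interpret moment_tree \<eta> \<kappa> wt \<mu>
    by (rule moment_tree.intro) (fact assms(2) e0 assms(4) assms(5) mass)+
  show ?thesis by (rule subnormal)
qed

end
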